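(* Let $G$ be a finite simple graph and let $T$ be a finite set (of colors). The following are equivalent: (1) There is a winning strategy for the graph coloring game for $(G,T)$ using quantum entanglement. (2) There exists a quantum family of proper graph colorings (of $G$ by $T$) indexed by a quantum set $\mathcal X$ that is nonempty, i.e. $\mathcal X \neq `\emptyset$. (3) There exists a quantum family of proper graph colorings (of $G$ by $T$) indexed by a quantum set $\mathcal H$ with $\mathrm{At}(\mathcal H)=\{H\}$ for some nonzero finite-dimensional Hilbert space $H$.
   Context: Graph coloring game for $(G,T)$: a referee separates two cooperating players and asks each of them about a vertex of $G$; each player responds with a color in $T$, without hearing the question to or the answer from the other player. If the two vertices are equal, the players win iff they respond with the same color; if the vertices are adjacent, they win iff they respond with different colors; otherwise they win automatically. A strategy using quantum entanglement consists of finite-dimensional Hilbert spaces $H_A,H_B$, a unit vector $\psi\in H_A\otimes H_B$, and for each vertex $g$ measurements (POVMs) $(E_{g,t})_{t\in T}$ on $H_A$ and $(E'_{g,t})_{t\in T}$ on $H_B$; on questions $g,g'$ the players answer $t,t'$ with probability $\langle\psi|(E_{g,t}\otimes E'_{g',t'})\psi\rangle$. It is winning if for every pair of questions the players win with probability $1$. Quantum sets: a quantum set $\mathcal X$ is determined by a set $\mathrm{At}(\mathcal X)$ of nonzero finite-dimensional complex Hilbert spaces, called its atoms; $X\propto\mathcal X$ means $X\in\mathrm{At}(\mathcal X)$. $L(X,Y)$ is the space of linear operators $X\to Y$. A binary relation $R$ from $\mathcal X$ to $\mathcal Y$ assigns to each $X\propto\mathcal X$, $Y\propto\mathcal Y$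 a linear subspace $R(X,Y)\le L(X,Y)$. Composition: $(S\circ R)(X,Z)=\mathrm{span}\{sr : Y\propto\mathcal Y,\ s\in S(Y,Z),\ r\in R(X,Y)\}$. Identity: $I_{\mathcal X}(X,X)=\mathbb C\cdot 1_X$ and $I_{\mathcal X}(X,X')=0$ for $X\ne X'$. Adjoint: $R^\dagger(Y,X)=\{r^\dagger : r\in R(X,Y)\}$. Order: $R\le S$ iff $R(X,Y)\le S(X,Y)$ for all $X,Y$. A function $F\colon\mathcal X\to\mathcal Y$ is a binary relation with $F^\dagger\circ F\ge I_{\mathcal X}$ and $F\circ F^\dagger\le I_{\mathcal Y}$. Cartesian product: $\mathcal X\times\mathcal Y$ has atoms $X\otimes Y$ for $X\propto\mathcal X$, $Y\propto\mathcal Y$ (distinct pairs give distinct atoms), and $(R_1\times R_2)(X_1\otimes X_2,Y_1\otimes Y_2)=\mathrm{span}\{r_1\otimes r_2 : r_i\in R_i(X_i,Y_i)\}$. Ordinary sets as quantum sets: for an ordinary set $S$, $`S$ is the quantum set with one one-dimensional atom $\mathbb C_s=\ell^2(\{s\})$ for each $s\in S$ (distinct for distinct $s$). For an ordinary binary relation (in particular a function) $r$ from $S$ to $S'$, $`r(\mathbb C_s,\mathbb C_{s'})=L(\mathbb C_s,\mathbb C_{s'})$ if $(s,s')\in r$ and $0$ otherwise. $`\emptyset$ is the quantum set with no atoms. Predicates: a predicate $P$ on $\mathcal X$ assigns to each $X\propto\mathcal X$ a subspace $P(X)\le X$. Predicates $P_1,P_2$ on $\mathcal X$ are disjoint if $P_1(X)\perp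 P_2(X)$ for all $X\propto\mathcal X$. For a function $F\colon\mathcal X\to\mathcal Y$ and a predicate $P$ on $\mathcal Y$, the inverse image $F^\star(P)$ is the predicate on $\mathcal X$ given by $F^\star(P)(X)=\mathrm{span}\{r^\dagger y : Y\propto\mathcal Y,\ y\in P(Y),\ r\in F(X,Y)\}$. For $t\in T$, $`\{t\}_T$ is the predicate on $`T$ with $`\{t\}_T(\mathbb C_t)=\mathbb C_t$ and $`\{t\}_T(\mathbb C_{t'})=0$ for $t'\neq t$. Quantum families: for a function $F\colon `G\times\mathcal X\to `T$ and a vertex $g\in G$, let $F_g=F\circ(`g\times I_{\mathcal X})\colon\mathcal X\to `T$, where $g$ also denotes the ordinary function $\{\ast\}\to G$ with value $g$ and $`\{\ast\}\times\mathcal X$ is identified with $\mathcal X$. A quantum family of proper graph colorings indexed by $\mathcal X$ is a function $F\colon `G\times\mathcal X\to `T$ such that for all adjacent vertices $g_1,g_2\in G$ and all $t\in T$ the predicates $F_{g_1}^\star(`\{t\}_T)$ and $F_{g_2}^\star(`\{t\}_T)$ on $\mathcal X$ are disjoint. *)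

theory Defs
  imports
    Complex_Main
    "HOL-Library.Function_Algebras"
    "HOL-Library.Infinite_Typeclass"
    "HOL-Library.Nonpos_Ints"
    "Graph_Theory.Pair_Digraph"
begin

section \<open>Finite-dimensional Hilbert spaces\<close>

text \<open>
  A finite-dimensional Hilbert space is \<open>\<ell>\<^sup>2(B)\<close> for a finite set \<open>B\<close>, and we identify it with the
  index set \<open>B\<close> of its orthonormal basis. It is nonzero iff \<open>B\<close> is nonempty, its vectors are the
  functions supported on \<open>B\<close>, and tensor products are given by
  \<open>\<ell>\<^sup>2(A) \<otimes> \<ell>\<^sup>2(B) = \<ell>\<^sup>2(A \<times> B)\<close>.

  A linear operator from \<open>\<ell>\<^sup>2(X)\<close> to \<open>\<ell>\<^sup>2(Y)\<close> is represented by its matrix, with rows indexed by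
  \<open>Y\<close> and columns indexed by \<open>X\<close>, i.e. by a function supported on \<open>Y \<times> X\<close>.
\<close>

definition cscale :: "complex \<Rightarrow> ('b \<Rightarrow> complex) \<Rightarrow> ('b \<Rightarrow> complex)" where
  "cscale c v = (\<lambda>i. c * v i)"

interpretation cfun: vector_space "cscale :: complex \<Rightarrow> ('b \<Rightarrow> complex) \<Rightarrow> ('b \<Rightarrow> complex)"
  by unfold_locales (auto simp: cscale_def fun_eq_iff algebra_simps)

abbreviation cspan :: "('b \<Rightarrow> complex) set \<Rightarrow> ('b \<Rightarrow> complex) set" where
  "cspan \<equiv> module.span cscale"

abbreviation csubspace :: "('b \<Rightarrow> complex) set \<Rightarrow> bool" where
  "csubspace \<equiv> module.subspace cscale"

definition ell2 :: "'b set \<Rightarrow> ('b \<Rightarrow> complex) set" where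
  "ell2 B = {v. \<forall>i. i \<notin> B \<longrightarrow> v i = 0}"

text \<open>The inner product is conjugate-linear in its first argument.\<close>

definition cinner :: "'b set \<Rightarrow> ('b \<Rightarrow> complex) \<Rightarrow> ('b \<Rightarrow> complex) \<Rightarrow> complex" where
  "cinner B u v = (\<Sum>i\<in>B. cnj (u i) * v i)"

definition lin_ops :: "'x set \<Rightarrow> 'y set \<Rightarrow> ('y \<times> 'x \<Rightarrow> complex) set" where
  "lin_ops X Y = ell2 (Y \<times> X)"

definition op_apply :: "'x set \<Rightarrow> ('y \<times> 'x \<Rightarrow> complex) \<Rightarrow> ('x \<Rightarrow> complex) \<Rightarrow> ('y \<Rightarrow> complex)" where
  "op_apply X r v = (\<lambda>j. \<Sum>i\<in>X. r (j, i) * v i)"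

text \<open>The index set argument of the composition is that of the intermediate space.\<close>

definition op_comp ::
  "'y set \<Rightarrow> ('z \<times> 'y \<Rightarrow> complex) \<Rightarrow> ('y \<times> 'x \<Rightarrow> complex) \<Rightarrow> ('z \<times> 'x \<Rightarrow> complex)" where
  "op_comp Y s r = (\<lambda>(k, i). \<Sum>j\<in>Y. s (k, j) * r (j, i))"

definition op_id :: "'x set \<Rightarrow> ('x \<times> 'x \<Rightarrow> complex)" where
  "op_id X = (\<lambda>(j, i). if i = j \<and> i \<in> X then 1 else 0)"

definition op_adj :: "('y \<times> 'x \<Rightarrow> complex) \<Rightarrow> ('x \<times> 'y \<Rightarrow> complex)" where
  "op_adj r = (\<lambda>(i, j). cnj (r (j, i)))"

definition op_tensor ::
  "('y1 \<times> 'x1 \<Rightarrow> complex) \<Rightarrow> ('y2 \<times> 'x2 \<Rightarrow> complex) \<Rightarrow>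
    (('y1 \<times> 'y2) \<times> ('x1 \<times> 'x2) \<Rightarrow> complex)" where
  "op_tensor r1 r2 = (\<lambda>((j1, j2), (i1, i2)). r1 (j1, i1) * r2 (j2, i2))"

definition op_positive :: "'x set \<Rightarrow> ('x \<times> 'x \<Rightarrow> complex) \<Rightarrow> bool" where
  "op_positive X r \<longleftrightarrow> (\<forall>v\<in>ell2 X. cinner X v (op_apply X r v) \<in> \<real>\<^sub>\<ge>\<^sub>0)"


section \<open>The graph coloring game\<close>

definition povm :: "'t set \<Rightarrow> 'x set \<Rightarrow> ('t \<Rightarrow> ('x \<times> 'x \<Rightarrow> complex)) \<Rightarrow> bool" where
  "povm T X E \<longleftrightarrow>
    (\<forall>t\<in>T. E t \<in> lin_ops X X \<and> op_positive X (E t)) \<and> (\<Sum>t\<in>T. E t) = op_id X"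

definition coloring_win :: "'g pair_pre_digraph \<Rightarrow> 'g \<Rightarrow> 'g \<Rightarrow> 't \<Rightarrow> 't \<Rightarrow> bool" where
  "coloring_win G g g' t t' \<longleftrightarrow>
    (g = g' \<longrightarrow> t = t') \<and> ((g, g') \<in> parcs G \<longrightarrow> t \<noteq> t')"

definition answer_prob ::
  "'a set \<Rightarrow> 'b set \<Rightarrow> ('a \<times> 'b \<Rightarrow> complex) \<Rightarrow>
    ('g \<Rightarrow> 't \<Rightarrow> ('a \<times> 'a \<Rightarrow> complex)) \<Rightarrow> ('g \<Rightarrow> 't \<Rightarrow> ('b \<times> 'b \<Rightarrow> complex)) \<Rightarrow>
    'g \<Rightarrow> 'g \<Rightarrow> 't \<Rightarrow> 't \<Rightarrow> complex" where
  "answer_prob A B \<psi> E E' g g' t t' =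
    cinner (A \<times> B) \<psi> (op_apply (A \<times> B) (op_tensor (E g t) (E' g' t')) \<psi>)"

definition entangled_strategy ::
  "'g pair_pre_digraph \<Rightarrow> 't set \<Rightarrow> 'a set \<Rightarrow> 'b set \<Rightarrow> ('a \<times> 'b \<Rightarrow> complex) \<Rightarrow>
    ('g \<Rightarrow> 't \<Rightarrow> ('a \<times> 'a \<Rightarrow> complex)) \<Rightarrow> ('g \<Rightarrow> 't \<Rightarrow> ('b \<times> 'b \<Rightarrow> complex)) \<Rightarrow> bool" where
  "entangled_strategy G T A B \<psi> E E' \<longleftrightarrow>
    finite A \<and> finite B \<and>
    \<psi> \<in> ell2 (A \<times> B) \<and> cinner (A \<times> B) \<psi> \<psi> = 1 \<and>
    (\<forall>g\<in>pverts G. povm T A (E g) \<and> povm T B (E' g))"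

definition winning_strategy ::
  "'g pair_pre_digraph \<Rightarrow> 't set \<Rightarrow> 'a set \<Rightarrow> 'b set \<Rightarrow> ('a \<times> 'b \<Rightarrow> complex) \<Rightarrow>
    ('g \<Rightarrow> 't \<Rightarrow> ('a \<times> 'a \<Rightarrow> complex)) \<Rightarrow> ('g \<Rightarrow> 't \<Rightarrow> ('b \<times> 'b \<Rightarrow> complex)) \<Rightarrow> bool" where
  "winning_strategy G T A B \<psi> E E' \<longleftrightarrow>
    entangled_strategy G T A B \<psi> E E' \<and>
    (\<forall>g\<in>pverts G. \<forall>g'\<in>pverts G.
      (\<Sum>(t, t')\<in>{(t, t') \<in> T \<times> T. coloring_win G g g' t t'}.
        answer_prob A B \<psi> E E' g g' t t') = 1)"


section \<open>Quantum sets\<close>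

text \<open>
  A quantum set is identified with its set of atoms. Since \<open>\<ell>\<^sup>2(X)\<close> is identified with \<open>X\<close>, it is a
  set of finite nonempty sets. Relations, predicates etc. are total functions of which only the
  values at atoms matter.
\<close>

definition quantum_set :: "'x set set \<Rightarrow> bool" where
  "quantum_set \<X> \<longleftrightarrow> (\<forall>X\<in>\<X>. finite X \<and> X \<noteq> {})"

type_synonym ('x, 'y) qrelation = "'x set \<Rightarrow> 'y set \<Rightarrow> ('y \<times> 'x \<Rightarrow> complex) set"

definition qrel :: "'x set set \<Rightarrow> 'y set set \<Rightarrow> ('x, 'y) qrelation \<Rightarrow> bool" where
  "qrel \<X> \<Y> R \<longleftrightarrow> (\<forall>X\<in>\<X>. \<forall>Y\<in>\<Y>. R X Y \<subseteq> lin_ops X Y \<and> csubspace (R X Y))"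

definition qrel_le ::
  "'x set set \<Rightarrow> 'y set set \<Rightarrow> ('x, 'y) qrelation \<Rightarrow> ('x, 'y) qrelation \<Rightarrow> bool" where
  "qrel_le \<X> \<Y> R S \<longleftrightarrow> (\<forall>X\<in>\<X>. \<forall>Y\<in>\<Y>. R X Y \<subseteq> S X Y)"

definition qrel_comp ::
  "'y set set \<Rightarrow> ('y, 'z) qrelation \<Rightarrow> ('x, 'y) qrelation \<Rightarrow> ('x, 'z) qrelation" where
  "qrel_comp \<Y> S R = (\<lambda>X Z. cspan {op_comp Y s r | Y s r. Y \<in> \<Y> \<and> s \<in> S Y Z \<and> r \<in> R X Y})"

definition qrel_id :: "('x, 'x) qrelation" where
  "qrel_id = (\<lambda>X X'. if X = X' then {cscale c (op_id X) | c. True} else {0})"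

definition qrel_adj :: "('x, 'y) qrelation \<Rightarrow> ('y, 'x) qrelation" where
  "qrel_adj R = (\<lambda>Y X. op_adj ` R X Y)"

definition qfunction :: "'x set set \<Rightarrow> 'y set set \<Rightarrow> ('x, 'y) qrelation \<Rightarrow> bool" where
  "qfunction \<X> \<Y> F \<longleftrightarrow>
    qrel \<X> \<Y> F \<and>
    qrel_le \<X> \<X> qrel_id (qrel_comp \<Y> (qrel_adj F) F) \<and>
    qrel_le \<Y> \<Y> (qrel_comp \<X> F (qrel_adj F)) qrel_id"

definition qset_prod :: "'x set set \<Rightarrow> 'y set set \<Rightarrow> ('x \<times> 'y) set set" where
  "qset_prod \<X> \<Y> = {X \<times> Y | X Y. X \<in> \<X> \<and> Y \<in> \<Y>}"

text \<open>
  As atoms are nonempty, an atom \<open>P = X1 \<times> X2\<close> of a product determines its factors, so the set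
  comprehension below ranges over a single choice of \<open>X1, X2, Y1, Y2\<close>.
\<close>

definition qrel_prod ::
  "('x1, 'y1) qrelation \<Rightarrow> ('x2, 'y2) qrelation \<Rightarrow> ('x1 \<times> 'x2, 'y1 \<times> 'y2) qrelation" where
  "qrel_prod R1 R2 = (\<lambda>P Q. cspan {op_tensor r1 r2 | X1 X2 Y1 Y2 r1 r2.
     P = X1 \<times> X2 \<and> Q = Y1 \<times> Y2 \<and> r1 \<in> R1 X1 Y1 \<and> r2 \<in> R2 X2 Y2})"

definition classical_qset :: "'s set \<Rightarrow> 's set set" where
  "classical_qset S = {{s} | s. s \<in> S}"

definition classical_qrel :: "('s \<times> 's') set \<Rightarrow> ('s, 's') qrelation" where
  "classical_qrel r =
    (\<lambda>A B. if \<exists>s s'. A = {s} \<and> B = {s'} \<and> (s, s') \<in> r then lin_ops A B else {0})"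


section \<open>Predicates on quantum sets\<close>

text \<open>A predicate assigns to each atom \<open>X\<close> a linear subspace of \<open>\<ell>\<^sup>2(X)\<close>.\<close>

type_synonym 'x qpredicate = "'x set \<Rightarrow> ('x \<Rightarrow> complex) set"

definition qpred_disjoint :: "'x set set \<Rightarrow> 'x qpredicate \<Rightarrow> 'x qpredicate \<Rightarrow> bool" where
  "qpred_disjoint \<X> P1 P2 \<longleftrightarrow> (\<forall>X\<in>\<X>. \<forall>u\<in>P1 X. \<forall>v\<in>P2 X. cinner X u v = 0)"

definition qpred_inv_image ::
  "'y set set \<Rightarrow> ('x, 'y) qrelation \<Rightarrow> 'y qpredicate \<Rightarrow> 'x qpredicate" where
  "qpred_inv_image \<Y> F P =
    (\<lambda>X. cspan {op_apply Y (op_adj r) y | Y y r. Y \<in> \<Y> \<and> y \<in> P Y \<and> r \<in> F X Y})"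

definition qpred_point :: "'t \<Rightarrow> 't qpredicate" where
  "qpred_point t = (\<lambda>Y. if Y = {t} then ell2 Y else {0})"


section \<open>Quantum families of proper graph colorings\<close>

text \<open>
  The member at \<open>g\<close> of a quantum family \<open>F\<close> from \<open>`V \<times> \<X>\<close> is \<open>F \<circ> (`g \<times> I)\<close>, where \<open>g\<close> is the
  function from the one-point set \<open>{()}\<close> with value \<open>g\<close>. The operator
  \<open>\<lambda>(j, i). r (j, ((), i))\<close> is \<open>r\<close> precomposed with the canonical unitary
  \<open>\<ell>\<^sup>2(X) \<cong> \<ell>\<^sup>2({()}) \<otimes> \<ell>\<^sup>2(X)\<close>; this implements the identification of \<open>`{()} \<times> \<X>\<close> with \<open>\<X>\<close>.
\<close>

definition qfamily_member ::
  "'g set \<Rightarrow> 'x set set \<Rightarrow> ('g \<times> 'x, 't) qrelation \<Rightarrow> 'g \<Rightarrow> ('x, 't) qrelation" where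
  "qfamily_member V \<X> F g = (\<lambda>X Y. (\<lambda>r. \<lambda>(j, i). r (j, ((), i))) `
    qrel_comp (qset_prod (classical_qset V) \<X>) F
      (qrel_prod (classical_qrel {((), g)}) qrel_id) ({()} \<times> X) Y)"

definition quantum_coloring_family ::
  "'g pair_pre_digraph \<Rightarrow> 't set \<Rightarrow> 'x set set \<Rightarrow> ('g \<times> 'x, 't) qrelation \<Rightarrow> bool" where
  "quantum_coloring_family G T \<X> F \<longleftrightarrow>
    qfunction (qset_prod (classical_qset (pverts G)) \<X>) (classical_qset T) F \<and>
    (\<forall>(g1, g2)\<in>parcs G. \<forall>t\<in>T.
      qpred_disjoint \<X>
        (qpred_inv_image (classical_qset T) (qfamily_member (pverts G) \<X> F g1) (qpred_point t))
        (qpred_inv_image (classical_qset T) (qfamily_member (pverts G) \<X> F g2) (qpred_point t)))"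

end

theory Submission
  imports Defs
begin

text \<open>
  All three conditions are equivalent to the existence of projective measurements \<open>(P\<^sub>g\<^sub>t)\<close> on one
  finite-dimensional Hilbert space with \<open>P\<^sub>g\<^sub>t P\<^sub>h\<^sub>t = 0\<close> for adjacent \<open>g\<close> and \<open>h\<close>.
  A quantum family assigns to each \<open>g\<close> a decomposition of every atom into orthogonal subspaces, one for
  each color, and \<open>P\<^sub>g\<^sub>t\<close> is the projection onto such a subspace; this allows restricting a family to a
  single atom. Projective measurements win the game on a maximally entangled state if the second player
  uses their transposes. Conversely, if \<open>\<psi>\<close> is the state of a winning strategy, read as an operator, then
  \<open>E\<^sub>g\<^sub>t \<psi> = \<psi> F\<^sub>g\<^sub>t\<close> with \<open>F\<^sub>g\<^sub>t\<close> the transpose of the second player's effect, so the range of \<open>\<psi>\<close> is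
  invariant under the \<open>E\<^sub>g\<^sub>t\<close>, and their restrictions to it are projective measurements as required.
\<close>

section \<open>Operator calculus\<close>

lemma sum_fun_apply: "(\<Sum>t\<in>T. f t) x = (\<Sum>t\<in>T. f t x)"
  by (induction T rule: infinite_finite_induct) auto

lemma op_comp_apply [simp]: "op_comp Y s r (k, i) = (\<Sum>j\<in>Y. s (k, j) * r (j, i))"
  by (simp add: op_comp_def)

lemma op_adj_apply [simp]: "op_adj r (i, j) = cnj (r (j, i))"
  by (simp add: op_adj_def)

lemma op_id_apply [simp]: "op_id X (j, i) = (if i = j \<and> i \<in> X then 1 else 0)"
  by (simp add: op_id_def)

lemma op_adj_adj [simp]: "op_adj (op_adj r) = r"
  by (auto simp: fun_eq_iff)

lemma op_adj_sum: "op_adj (\<Sum>t\<in>T. f t) = (\<Sum>t\<in>T. op_adj (f t))"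
  by (auto simp: fun_eq_iff sum_fun_apply)

lemma op_adj_comp: "op_adj (op_comp Y s r) = op_comp Y (op_adj r) (op_adj s)"
  by (auto simp: fun_eq_iff mult.commute)

lemma op_adj_id [simp]: "op_adj (op_id X) = op_id X"
  by (auto simp: fun_eq_iff)

lemma op_comp_assoc:
  "op_comp Z t (op_comp Y s r) = op_comp Y (op_comp Z t s) r"
proof -
  have "(\<Sum>j\<in>Z. t (k, j) * (\<Sum>l\<in>Y. s (j, l) * r (l, i))) =
        (\<Sum>l\<in>Y. (\<Sum>j\<in>Z. t (k, j) * s (j, l)) * r (l, i))" for k i
    by (simp add: sum_distrib_left sum_distrib_right mult.assoc) (rule sum.swap)
  then show ?thesis by (auto simp: fun_eq_iff)
qed

lemma op_comp_zero [simp]: "op_comp Y 0 r = 0" "op_comp Y s 0 = 0"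
  by (auto simp: fun_eq_iff)

lemma op_comp_sum_left: "op_comp Y (\<Sum>t\<in>T. f t) r = (\<Sum>t\<in>T. op_comp Y (f t) r)"
proof -
  have "op_comp Y (\<Sum>t\<in>T. f t) r (k, i) = (\<Sum>t\<in>T. op_comp Y (f t) r) (k, i)" for k i
    by (simp add: sum_fun_apply sum_distrib_right) (rule sum.swap)
  then show ?thesis by (auto simp: fun_eq_iff)
qed

lemma op_comp_sum_right: "op_comp Y s (\<Sum>t\<in>T. f t) = (\<Sum>t\<in>T. op_comp Y s (f t))"
proof -
  have "op_comp Y s (\<Sum>t\<in>T. f t) (k, i) = (\<Sum>t\<in>T. op_comp Y s (f t)) (k, i)" for k i
    by (simp add: sum_fun_apply sum_distrib_left) (rule sum.swap)
  then show ?thesis by (auto simp: fun_eq_iff)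
qed

lemma op_comp_scale:
  "op_comp Y (cscale c s) r = cscale c (op_comp Y s r)"
  "op_comp Y s (cscale c r) = cscale c (op_comp Y s r)"
  by (auto simp: fun_eq_iff cscale_def sum_distrib_left algebra_simps)

lemma op_comp_add:
  "op_comp Y (s + s') r = op_comp Y s r + op_comp Y s' r"
  "op_comp Y s (r + r') = op_comp Y s r + op_comp Y s r'"
  by (auto simp: fun_eq_iff sum.distrib algebra_simps)

lemma lin_ops_iff: "r \<in> lin_ops X Y \<longleftrightarrow> (\<forall>j i. j \<notin> Y \<or> i \<notin> X \<longrightarrow> r (j, i) = 0)"
  by (auto simp: lin_ops_def ell2_def)

lemma lin_ops_outside: "r \<in> lin_ops X Y \<Longrightarrow> j \<notin> Y \<or> i \<notin> X \<Longrightarrow> r (j, i) = 0"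
  by (auto simp: lin_ops_iff)

lemma lin_ops_eqI:
  assumes "r \<in> lin_ops X Y" "s \<in> lin_ops X Y" "\<And>j i. j \<in> Y \<Longrightarrow> i \<in> X \<Longrightarrow> r (j, i) = s (j, i)"
  shows "r = s"
  using assms by (auto simp: fun_eq_iff lin_ops_iff) metis

lemma op_comp_lin_ops: "s \<in> lin_ops Y Z \<Longrightarrow> r \<in> lin_ops X Y \<Longrightarrow> op_comp Y s r \<in> lin_ops X Z"
  by (auto simp: lin_ops_iff)

lemma op_adj_lin_ops: "r \<in> lin_ops X Y \<Longrightarrow> op_adj r \<in> lin_ops Y X"
  by (auto simp: lin_ops_iff)

lemma csubspace_lin_ops: "csubspace (lin_ops X Y)"
  by (auto simp: cfun.subspace_def lin_ops_iff cscale_def)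

lemma op_comp_id_right:
  assumes "finite X" "r \<in> lin_ops X Y" shows "op_comp X r (op_id X) = r"
proof -
  have "op_comp X r (op_id X) (k, i) = r (k, i)" for k i
  proof -
    have "op_comp X r (op_id X) (k, i) = (\<Sum>j\<in>X. if j = i then r (k, i) else 0)"
      by (auto intro!: sum.cong)
    then show ?thesis using assms by (auto simp: lin_ops_iff)
  qed
  then show ?thesis by (auto simp: fun_eq_iff)
qed

lemma op_comp_id_left:
  assumes "finite Y" "r \<in> lin_ops X Y" shows "op_comp Y (op_id Y) r = r"
  using op_comp_id_right[OF assms(1) op_adj_lin_ops[OF assms(2)]]
  by (metis op_adj_adj op_adj_comp op_adj_id)

section \<open>Inner products of vectors and of matrices\<close>

lemma cinner_self: "cinner X v v = complex_of_real (\<Sum>i\<in>X. (norm (v i))\<^sup>2)"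
  unfolding cinner_def of_real_sum
  by (intro sum.cong refl) (metis complex_norm_square mult.commute of_real_power)

lemma cinner_self_nonneg: "cinner X v v \<in> \<real>\<^sub>\<ge>\<^sub>0"
  unfolding cinner_self by (intro nonneg_Reals_of_real_iff[THEN iffD2] sum_nonneg) simp

lemma cinner_self_eq_0_iff:
  assumes "finite X" shows "cinner X v v = 0 \<longleftrightarrow> (\<forall>i\<in>X. v i = 0)"
  unfolding cinner_self of_real_eq_0_iff using assms by (subst sum_nonneg_eq_0_iff) auto

lemma cinner_Times: "cinner (X \<times> Y) u v = (\<Sum>x\<in>X. \<Sum>y\<in>Y. cnj (u (x, y)) * v (x, y))"
  by (simp add: cinner_def sum.cartesian_product split_def)

text \<open>Matrices are vectors indexed by pairs, so \<open>cinner\<close> on a product index set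
  is the Hilbert-Schmidt inner product; for it, left multiplications by \<open>k\<close> and by
  \<open>op_adj k\<close> are adjoint. This lets a state on \<open>A \<times> B\<close> be handled
  as a matrix.\<close>

lemma cinner_op_adj_left:
  "cinner (Z \<times> X) u (op_comp Y (op_adj k) w) = cinner (Y \<times> X) (op_comp Z k u) w"
proof -
  have "cinner (Z \<times> X) u (op_comp Y (op_adj k) w)
      = (\<Sum>z\<in>Z. \<Sum>x\<in>X. \<Sum>y\<in>Y. cnj (u (z, x)) * cnj (k (y, z)) * w (y, x))"
    by (simp add: cinner_Times sum_distrib_left mult.assoc)
  also have "\<dots> = (\<Sum>z\<in>Z. \<Sum>y\<in>Y. \<Sum>x\<in>X. cnj (u (z, x)) * cnj (k (y, z)) * w (y, x))"
    by (intro sum.cong refl, rule sum.swap)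
  also have "\<dots> = (\<Sum>y\<in>Y. \<Sum>z\<in>Z. \<Sum>x\<in>X. cnj (u (z, x)) * cnj (k (y, z)) * w (y, x))"
    by (rule sum.swap)
  also have "\<dots> = (\<Sum>y\<in>Y. \<Sum>x\<in>X. \<Sum>z\<in>Z. cnj (u (z, x)) * cnj (k (y, z)) * w (y, x))"
    by (intro sum.cong refl, rule sum.swap)
  also have "\<dots> = cinner (Y \<times> X) (op_comp Z k u) w"
    by (simp add: cinner_Times sum_distrib_left sum_distrib_right mult_ac)
  finally show ?thesis .
qed

lemma cinner_op_adj: "cinner (X \<times> Y) (op_adj u) (op_adj v) = cnj (cinner (Y \<times> X) u v)"
proof -
  have "cinner (X \<times> Y) (op_adj u) (op_adj v) = (\<Sum>x\<in>X. \<Sum>y\<in>Y. u (y, x) * cnj (v (y, x)))"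
    by (simp add: cinner_def sum.cartesian_product op_adj_def split_def)
  also have "\<dots> = (\<Sum>y\<in>Y. \<Sum>x\<in>X. u (y, x) * cnj (v (y, x)))"
    by (rule sum.swap)
  also have "\<dots> = cnj (cinner (Y \<times> X) u v)"
    by (simp add: cinner_def sum.cartesian_product split_def)
  finally show ?thesis .
qed

text \<open>Taking adjoints turns right multiplication into left multiplication and conjugates the
  inner product.\<close>

lemma cinner_op_adj_right:
  "cinner (Z \<times> X) u (op_comp Y w k) = cinner (Z \<times> Y) (op_comp X u (op_adj k)) w"
proof -
  have "cinner (Z \<times> X) u (op_comp Y w k) = cnj (cinner (X \<times> Z) (op_adj u) (op_adj (op_comp Y w k)))"
    by (simp add: cinner_op_adj)
  also have "\<dots> = cnj (cinner (Y \<times> Z) (op_comp X k (op_adj u)) (op_adj w))"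
    by (simp add: op_adj_comp cinner_op_adj_left)
  also have "\<dots> = cinner (Z \<times> Y) (op_comp X u (op_adj k)) w"
    by (metis cinner_op_adj complex_cnj_cnj op_adj_adj op_adj_comp)
  finally show ?thesis .
qed

section \<open>Transposes and operators on a tensor product\<close>

definition op_trans :: "('y \<times> 'x \<Rightarrow> complex) \<Rightarrow> ('x \<times> 'y \<Rightarrow> complex)" where
  "op_trans r = (\<lambda>(i, j). r (j, i))"

lemma op_trans_apply [simp]: "op_trans r (i, j) = r (j, i)"
  by (simp add: op_trans_def)

lemma op_trans_trans [simp]: "op_trans (op_trans r) = r"
  by (auto simp: fun_eq_iff)

lemma op_trans_lin_ops: "r \<in> lin_ops X Y \<Longrightarrow> op_trans r \<in> lin_ops Y X"
  by (auto simp: lin_ops_iff)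

lemma op_trans_sum: "op_trans (\<Sum>t\<in>T. f t) = (\<Sum>t\<in>T. op_trans (f t))"
  by (auto simp: fun_eq_iff sum_fun_apply)

lemma op_trans_id [simp]: "op_trans (op_id X) = op_id X"
  by (auto simp: fun_eq_iff)

text \<open>With a tensor read as a matrix, the first factor acts on the row index and the second on
  the column index. Acting on columns is multiplication from the right by the plain transpose,
  without conjugation.\<close>

lemma op_apply_tensor:
  "op_apply (A \<times> B) (op_tensor r s) v = op_comp B (op_comp A r v) (op_trans s)"
proof -
  have "op_apply (A \<times> B) (op_tensor r s) v (i, j) = op_comp B (op_comp A r v) (op_trans s) (i, j)" for i j
  proof -
    have "op_apply (A \<times> B) (op_tensor r s) v (i, j) = (\<Sum>a\<in>A. \<Sum>b\<in>B. r (i, a) * s (j, b) * v (a, b))"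
      by (simp add: op_apply_def op_tensor_def sum.cartesian_product split_def)
    also have "\<dots> = (\<Sum>b\<in>B. \<Sum>a\<in>A. r (i, a) * s (j, b) * v (a, b))"
      by (rule sum.swap)
    finally show ?thesis by (simp add: sum_distrib_left sum_distrib_right mult_ac)
  qed
  then show ?thesis by (auto simp: fun_eq_iff)
qed

lemma cinner_sum_right: "cinner X u (\<Sum>t\<in>T. f t) = (\<Sum>t\<in>T. cinner X u (f t))"
  unfolding cinner_def sum_fun_apply sum_distrib_left by (rule sum.swap)

lemma cinner_zero_right [simp]: "cinner X u 0 = 0"
  by (simp add: cinner_def)

section \<open>Positive operators\<close>

lemma op_positive_trans:
  assumes "op_positive X r" shows "op_positive X (op_trans r)"
  unfolding op_positive_def
proof
  fix v :: "'a \<Rightarrow> complex" assume "v \<in> ell2 X"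
  \<comment> \<open>The form of the transpose at \<open>v\<close> is the form of \<open>r\<close> at
    the complex conjugate of \<open>v\<close>.\<close>
  then have "(\<lambda>i. cnj (v i)) \<in> ell2 X" by (auto simp: ell2_def)
  then have "cinner X (\<lambda>i. cnj (v i)) (op_apply X r (\<lambda>i. cnj (v i))) \<in> \<real>\<^sub>\<ge>\<^sub>0"
    using assms by (auto simp: op_positive_def)
  also have "cinner X (\<lambda>i. cnj (v i)) (op_apply X r (\<lambda>i. cnj (v i))) = cinner X v (op_apply X (op_trans r) v)"
    unfolding cinner_def op_apply_def sum_distrib_left
    by (subst sum.swap) (simp add: mult_ac)
  finally show "cinner X v (op_apply X (op_trans r) v) \<in> \<real>\<^sub>\<ge>\<^sub>0" .
qed

text \<open>The quadratic form at \<open>v\<close> is the squared norm of \<open>k\<close> applied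
  to \<open>v\<close>.\<close>

lemma op_positive_adj_comp:
  "op_positive X (op_comp Y (op_adj k) k)"
  unfolding op_positive_def
proof
  fix v :: "'a \<Rightarrow> complex"
  have "cinner X v (op_apply X (op_comp Y (op_adj k) k) v)
      = (\<Sum>i\<in>X. \<Sum>j\<in>X. \<Sum>y\<in>Y. cnj (v i) * cnj (k (y, i)) * k (y, j) * v j)"
    by (simp add: cinner_def op_apply_def sum_distrib_left sum_distrib_right mult_ac)
  also have "\<dots> = (\<Sum>i\<in>X. \<Sum>y\<in>Y. \<Sum>j\<in>X. cnj (v i) * cnj (k (y, i)) * k (y, j) * v j)"
    by (intro sum.cong refl, rule sum.swap)
  also have "\<dots> = (\<Sum>y\<in>Y. \<Sum>i\<in>X. \<Sum>j\<in>X. cnj (v i) * cnj (k (y, i)) * k (y, j) * v j)"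
    by (rule sum.swap)
  also have "\<dots> = cinner Y (op_apply X k v) (op_apply X k v)"
    by (simp add: cinner_def op_apply_def sum_distrib_left sum_distrib_right mult_ac)
  finally show "cinner X v (op_apply X (op_comp Y (op_adj k) k) v) \<in> \<real>\<^sub>\<ge>\<^sub>0"
    by (simp add: cinner_self_nonneg)
qed

section \<open>Projective colorings\<close>

text \<open>The range of \<open>P g t\<close> is the subspace on which vertex \<open>g\<close> has
  color \<open>t\<close>: the subspaces of one vertex decompose the space, and adjacent vertices
  have orthogonal subspaces for the same color. Idempotence of \<open>P g t\<close> follows from the
  clauses.\<close>

definition projective_coloring ::
  "'g pair_pre_digraph \<Rightarrow> 't set \<Rightarrow> 'x set \<Rightarrow> ('g \<Rightarrow> 't \<Rightarrow> ('x \<times> 'x \<Rightarrow> complex)) \<Rightarrow> bool" where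
  "projective_coloring G T H P \<longleftrightarrow>
    (\<forall>g\<in>pverts G.
      (\<forall>t\<in>T. P g t \<in> lin_ops H H \<and> op_adj (P g t) = P g t) \<and>
      (\<Sum>t\<in>T. P g t) = op_id H \<and>
      (\<forall>t\<in>T. \<forall>t'\<in>T. t \<noteq> t' \<longrightarrow> op_comp H (P g t) (P g t') = 0)) \<and>
    (\<forall>(g, g')\<in>parcs G. \<forall>t\<in>T. op_comp H (P g t) (P g' t) = 0)"

lemma projective_coloringD:
  assumes "projective_coloring G T H P"
  shows "g \<in> pverts G \<Longrightarrow> t \<in> T \<Longrightarrow> P g t \<in> lin_ops H H"
    and "g \<in> pverts G \<Longrightarrow> t \<in> T \<Longrightarrow> op_adj (P g t) = P g t"
    and "g \<in> pverts G \<Longrightarrow> (\<Sum>t\<in>T. P g t) = op_id H"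
    and "g \<in> pverts G \<Longrightarrow> t \<in> T \<Longrightarrow> t' \<in> T \<Longrightarrow> t \<noteq> t' \<Longrightarrow> op_comp H (P g t) (P g t') = 0"
    and "(g, g') \<in> parcs G \<Longrightarrow> t \<in> T \<Longrightarrow> op_comp H (P g t) (P g' t) = 0"
  using assms unfolding projective_coloring_def by blast+

text \<open>Multiplying \<open>P g t\<close> by the sum of all \<open>P g t'\<close>, which is the
  identity, leaves only the term \<open>t' = t\<close> by orthogonality.\<close>

lemma projective_coloring_idem:
  assumes "projective_coloring G T H P" "finite T" "finite H" "g \<in> pverts G" "t \<in> T"
  shows "op_comp H (P g t) (P g t) = P g t"
proof -
  note D = projective_coloringD[OF assms(1)]
  have "P g t = op_comp H (P g t) (\<Sum>t'\<in>T. P g t')"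
    using assms by (simp add: D op_comp_id_right[where Y = H])
  also have "\<dots> = (\<Sum>t'\<in>T. if t' = t then op_comp H (P g t) (P g t) else 0)"
    unfolding op_comp_sum_right using assms D(4) by (intro sum.cong) auto
  finally show ?thesis using assms by simp
qed

lemma pair_graph_arc_verts:
  assumes "pair_graph G" "(g, g') \<in> parcs G"
  shows "g \<in> pverts G" "g' \<in> pverts G"
proof -
  interpret pair_graph G by fact
  show "g \<in> pverts G" "g' \<in> pverts G" using assms(2) by (auto dest: in_arcsD1 in_arcsD2)
qed

text \<open>\<open>U\<close> is an isometry, so \<open>op_comp H U (op_adj U)\<close> is the
  projection onto its range, and \<open>inv\<close> says that the range is invariant under the
  \<open>E g t\<close>. The projection therefore drops out between two compressed operators, and
  orthogonality on the range of \<open>U\<close> is enough.\<close>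

lemma projective_coloring_compress:
  assumes "pair_graph G" "finite A" "finite H"
    and U: "U \<in> lin_ops H A" "op_comp A (op_adj U) U = op_id H"
    and E: "\<And>g t. g \<in> pverts G \<Longrightarrow> t \<in> T \<Longrightarrow> E g t \<in> lin_ops A A"
      "\<And>g t. g \<in> pverts G \<Longrightarrow> t \<in> T \<Longrightarrow> op_adj (E g t) = E g t"
      "\<And>g. g \<in> pverts G \<Longrightarrow> (\<Sum>t\<in>T. E g t) = op_id A"
    and inv: "\<And>g t. g \<in> pverts G \<Longrightarrow> t \<in> T \<Longrightarrow>
      op_comp H U (op_comp A (op_adj U) (op_comp A (E g t) U)) = op_comp A (E g t) U"
    and orth: "\<And>g t t'. g \<in> pverts G \<Longrightarrow> t \<in> T \<Longrightarrow> t' \<in> T \<Longrightarrow> t \<noteq> t' \<Longrightarrow>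
      op_comp A (E g t) (op_comp A (E g t') U) = 0"
    and arc: "\<And>g g' t. (g, g') \<in> parcs G \<Longrightarrow> t \<in> T \<Longrightarrow> 
      op_comp A (E g t) (op_comp A (E g' t) U) = 0"
  shows "projective_coloring G T H (\<lambda>g t. op_comp A (op_adj U) (op_comp A (E g t) U))"
proof -
  note vert = pair_graph_arc_verts[OF assms(1)]
  have "(\<Sum>t\<in>T. op_comp A (op_adj U) (op_comp A (E g t) U)) = op_id H" if "g \<in> pverts G" for g
    using that assms by (simp flip: op_comp_sum_right op_comp_sum_left add: op_comp_id_left[where X = H])
  then show ?thesis
    unfolding projective_coloring_def
    by (auto simp: op_adj_comp E inv orth arc vert simp flip: op_comp_assoc
        intro!: op_comp_lin_ops[where Y = A] op_adj_lin_ops U)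
qed

text \<open>The permutation matrix of a bijection with a set of equal size, which every infinite
  type contains.\<close>

lemma ex_unitary:
  assumes "finite X"
  obtains Y :: "'y::infinite set" and U where "finite Y" "Y = {} \<longleftrightarrow> X = {}" "U \<in> lin_ops Y X"
    "op_comp X (op_adj U) U = op_id Y" "op_comp Y U (op_adj U) = op_id X"
proof -
  obtain Y :: "'y set" where Y: "finite Y" "card Y = card X"
    using infinite_arbitrarily_large[OF infinite_UNIV] by blast
  then obtain f where f: "bij_betw f Y X"
    using assms finite_same_card_bij by blast
  define U where "U = (\<lambda>(x, y). if y \<in> Y \<and> x = f y then 1 else 0 :: complex)"
  have 1: "U \<in> lin_ops Y X"
    using f by (auto simp: lin_ops_iff U_def bij_betw_def)
  have 2: "op_comp X (op_adj U) U = op_id Y"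
  proof -
    have "op_comp X (op_adj U) U (y, y') = op_id Y (y, y')" for y y'
    proof -
      have "op_comp X (op_adj U) U (y, y') =
          (\<Sum>x\<in>X. if x = f y then (if y \<in> Y \<and> y' \<in> Y \<and> f y = f y' then 1 else 0) else 0)"
        unfolding op_comp_apply by (intro sum.cong) (auto simp: U_def)
      also have "\<dots> = op_id Y (y, y')"
        using assms f by (auto simp: bij_betw_def inj_on_def)
      finally show ?thesis .
    qed
    then show ?thesis by (auto simp: fun_eq_iff)
  qed
  have 3: "op_comp Y U (op_adj U) = op_id X"
  proof -
    have "op_comp Y U (op_adj U) (x, x') = op_id X (x, x')" for x x'
    proof -
      have "op_comp Y U (op_adj U) (x, x') =
          (\<Sum>y\<in>Y. if y = inv_into Y f x then (if x = x' \<and> x \<in> X then 1 else 0) else 0)"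
        unfolding op_comp_apply using f
        by (intro sum.cong) (auto simp: U_def bij_betw_def f_inv_into_f)
      also have "\<dots> = op_id X (x, x')"
        using Y f by (auto simp: bij_betw_def inv_into_into)
      finally show ?thesis .
    qed
    then show ?thesis by (auto simp: fun_eq_iff)
  qed
  have "Y = {} \<longleftrightarrow> X = {}" using Y assms by (metis card_0_eq)
  with Y 1 2 3 show ?thesis by (intro that)
qed

text \<open>Conjugation by a unitary is the compression whose range is the whole space. It
  reconciles the different index types of the three conditions.\<close>

lemma projective_coloring_transport:
  assumes "pair_graph G" "finite T" "finite H" "H \<noteq> {}" "projective_coloring G T H P"
  obtains A :: "'a::infinite set" and Q where "finite A" "A \<noteq> {}" "projective_coloring G T A Q"
proof -
  note vert = pair_graph_arc_verts[OF assms(1)]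
  note D = projective_coloringD[OF assms(5)]
  obtain A :: "'a set" and U where U: "finite A" "A = {} \<longleftrightarrow> H = {}" "U \<in> lin_ops A H"
    "op_comp H (op_adj U) U = op_id A" "op_comp A U (op_adj U) = op_id H"
    using ex_unitary[OF assms(3)] by metis
  have "projective_coloring G T A (\<lambda>g t. op_comp H (op_adj U) (op_comp H (P g t) U))"
  proof (rule projective_coloring_compress)
    show "op_comp A U (op_comp H (op_adj U) (op_comp H (P g t) U)) = op_comp H (P g t) U"
      if "g \<in> pverts G" "t \<in> T" for g t
      using that assms U
      by (simp add: op_comp_assoc[of A U] op_comp_id_left[where X = A] op_comp_lin_ops[where Y = H] D)
  qed (use assms U D vert in \<open>simp_all add: op_comp_assoc\<close>)
  with U assms that show ?thesis by blast
qed

section \<open>Answer probabilities and the strategy of a projective coloring\<close>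

lemma answer_prob_eq:
  "answer_prob A B \<psi> E E' g g' t t' =
    cinner (A \<times> B) \<psi> (op_comp B (op_comp A (E g t) \<psi>) (op_trans (E' g' t')))"
  by (simp add: answer_prob_def op_apply_tensor)

text \<open>Both measurements sum to the identity, so the sum collapses to the squared norm of the
  state.\<close>

lemma sum_answer_prob:
  assumes "entangled_strategy G T A B \<psi> E E'" "g \<in> pverts G" "g' \<in> pverts G"
  shows "(\<Sum>(t, t')\<in>T \<times> T. answer_prob A B \<psi> E E' g g' t t') = 1"
proof -
  have fin: "finite A" "finite B" and psi: "\<psi> \<in> lin_ops B A" "cinner (A \<times> B) \<psi> \<psi> = 1"
    and sums: "(\<Sum>t\<in>T. E g t) = op_id A" "(\<Sum>t\<in>T. E' g' t) = op_id B"
    using assms by (auto simp: entangled_strategy_def povm_def lin_ops_def)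
  have "(\<Sum>(t, t')\<in>T \<times> T. answer_prob A B \<psi> E E' g g' t t') =
      cinner (A \<times> B) \<psi> (\<Sum>t\<in>T. \<Sum>t'\<in>T. op_comp B (op_comp A (E g t) \<psi>) (op_trans (E' g' t')))"
    by (simp add: answer_prob_eq cinner_sum_right flip: sum.cartesian_product)
  also have "\<dots> = cinner (A \<times> B) \<psi> \<psi>"
    using fin psi sums
    by (simp flip: op_comp_sum_right op_comp_sum_left op_trans_sum
        add: op_comp_id_left[where X = B] op_comp_id_right[where Y = A])
  finally show ?thesis using psi by simp
qed

text \<open>On the maximally entangled state, the second player's transposed projection can be moved
  to the first player's side. The probability of \<open>t, t'\<close> then contains the product of
  \<open>Q g t\<close> and \<open>Q g' t'\<close>, which vanishes for losing answers.\<close>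

lemma winning_strategy_of_projective_coloring:
  assumes G: "pair_graph G" and T: "finite T" and H: "finite H" "H \<noteq> {}"
    and P: "projective_coloring G T H P"
  shows "\<exists>(A :: 'a::infinite set) (B :: 'b::infinite set) \<psi> E E'. winning_strategy G T A B \<psi> E E'"
proof -
  obtain A :: "'a set" and Q where A: "finite A" "A \<noteq> {}" and Q: "projective_coloring G T A Q"
    using projective_coloring_transport[OF G T H P] by blast
  note D = projective_coloringD[OF Q]
  obtain B :: "'b set" and W where B: "finite B" "B = {} \<longleftrightarrow> A = {}" and W: "W \<in> lin_ops B A"
    "op_comp A (op_adj W) W = op_id B" "op_comp B W (op_adj W) = op_id A"
    using ex_unitary[OF A(1)] by metis
  \<comment> \<open>The squared norm of \<open>W\<close> is the trace of the identity on
    \<open>B\<close>, that is \<open>card B\<close>; the factor \<open>c\<close> normalizes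
    it.\<close>
  define c where "c = complex_of_real (1 / sqrt (card B))"
  define \<psi> where "\<psi> = cscale c W"
  define E' where "E' = (\<lambda>g t. op_trans (op_comp A (op_adj W) (op_comp A (Q g t) W)))"
  have psi: "\<psi> \<in> lin_ops B A"
    using W(1) by (auto simp: \<psi>_def lin_ops_iff cscale_def)
  have "cinner (A \<times> B) W W = (\<Sum>b\<in>B. op_comp A (op_adj W) W (b, b))"
    by (simp add: cinner_Times sum.swap[of _ B A])
  also have "\<dots> = of_nat (card B)" by (simp add: W(2) del: op_comp_apply)
  finally have WW: "cinner (A \<times> B) W W = of_nat (card B)" .
  have "cinner (A \<times> B) \<psi> \<psi> = cnj c * c * cinner (A \<times> B) W W"
    by (simp add: \<psi>_def cscale_def cinner_def sum_distrib_left mult_ac)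
  also have "cnj c * c = complex_of_real (1 / real (card B))"
    unfolding c_def by (simp flip: of_real_mult)
  finally have norm: "cinner (A \<times> B) \<psi> \<psi> = 1"
    using A B by (simp add: WW)
  \<comment> \<open>A self-adjoint idempotent equals its adjoint times itself.\<close>
  have pos: "op_positive A (Q g t)" if "g \<in> pverts G" "t \<in> T" for g t
    using op_positive_adj_comp[of A A "Q g t"] projective_coloring_idem[OF Q T A(1)] D that by simp
  \<comment> \<open>The same factorization after conjugation by \<open>W\<close>, in the form that
    shows positivity.\<close>
  have QW: "op_comp A (op_adj W) (op_comp A (Q g t) W) =
      op_comp A (op_adj (op_comp A (Q g t) W)) (op_comp A (Q g t) W)" if "g \<in> pverts G" "t \<in> T" for g t
    using projective_coloring_idem[OF Q T A(1)] D that
    by (simp add: op_adj_comp op_comp_assoc) (simp flip: op_comp_assoc)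
  have "povm T A (Q g)" if "g \<in> pverts G" for g
    using that D pos by (auto simp: povm_def)
  moreover have "povm T B (E' g)" if "g \<in> pverts G" for g
    unfolding povm_def E'_def
  proof (intro conjI ballI)
    show "op_positive B (op_trans (op_comp A (op_adj W) (op_comp A (Q g t) W)))" if "t \<in> T" for t
      unfolding QW[OF \<open>g \<in> pverts G\<close> that] by (intro op_positive_trans op_positive_adj_comp)
    show "(\<Sum>t\<in>T. op_trans (op_comp A (op_adj W) (op_comp A (Q g t) W))) = op_id B"
      using that A W D by (simp flip: op_comp_sum_right op_comp_sum_left op_trans_sum
        add: op_comp_id_left[where X = B])
  qed (use that W D in \<open>auto intro!: op_trans_lin_ops op_comp_lin_ops[where Y = A] op_adj_lin_ops\<close>)
  ultimately have strat: "entangled_strategy G T A B \<psi> Q E'"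
    using A B psi norm by (simp add: entangled_strategy_def lin_ops_def)
  \<comment> \<open>The transpose in \<open>E'\<close> cancels the one in
    \<open>answer_prob_eq\<close>, and \<open>W\<close> times its adjoint is the identity, so the
    second player's projection passes to the left of the state.\<close>
  have prob: "answer_prob A B \<psi> Q E' g g' t t' = 
      cinner (A \<times> B) \<psi> (op_comp A (op_comp A (Q g t) (Q g' t')) \<psi>)"
    if "g' \<in> pverts G" "t' \<in> T" for g g' t t'
  proof -
    have "op_comp B (op_comp A (Q g t) W) (op_comp A (op_adj W) (op_comp A (Q g' t') W)) =
        op_comp A (Q g t) (op_comp A (op_comp B W (op_adj W)) (op_comp A (Q g' t') W))"
      by (simp flip: op_comp_assoc)
    also have "\<dots> = op_comp A (op_comp A (Q g t) (Q g' t')) W"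
      using A W that D
      by (simp add: op_comp_id_left[where X = B] op_comp_lin_ops[where Y = A]) (simp add: op_comp_assoc)
    finally show ?thesis
      by (simp add: answer_prob_eq E'_def \<psi>_def op_comp_scale)
  qed
  have "winning_strategy G T A B \<psi> Q E'"
    unfolding winning_strategy_def
  proof (intro conjI ballI strat)
    fix g g' assume g: "g \<in> pverts G" "g' \<in> pverts G"
    \<comment> \<open>A losing pair has either equal questions and distinct colors or adjacent
      questions and equal colors; in both cases the product of projections is zero.\<close>
    have "(\<Sum>(t, t')\<in>{(t, t') \<in> T \<times> T. coloring_win G g g' t t'}. answer_prob A B \<psi> Q E' g g' t t') =
        (\<Sum>(t, t')\<in>T \<times> T. answer_prob A B \<psi> Q E' g g' t t')"
      using T D g by (intro sum.mono_neutral_left) (fastforce simp: coloring_win_def prob)+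
    then show "(\<Sum>(t, t')\<in>{(t, t') \<in> T \<times> T. coloring_win G g g' t t'}. answer_prob A B \<psi> Q E' g g' t t') = 1"
      using sum_answer_prob[OF strat g] by simp
  qed
  then show ?thesis by blast
qed

section \<open>Winning strategies yield projective colorings\<close>

lemma cinner_op_apply_insert:
  assumes "finite Y" "i \<notin> Y"
  shows "cinner (insert i Y) w (op_apply (insert i Y) r w) =
    cnj (w i) * r (i, i) * w i + cnj (w i) * (\<Sum>j\<in>Y. r (i, j) * w j) +
    (\<Sum>j\<in>Y. cnj (w j) * r (j, i)) * w i + cinner Y w (op_apply Y r w)"
  using assms
  by (simp add: cinner_def op_apply_def algebra_simps sum.distrib sum_distrib_left sum_distrib_right)

text \<open>Vectors supported on two indices see only a 2 by 2 principal block. They are the test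
  vectors for off-diagonal entries.\<close>

lemma cinner_op_apply_pair:
  fixes x y :: complex
  assumes "finite X" "a \<in> X" "b \<in> X" "a \<noteq> b"
  defines "v \<equiv> (\<lambda>l. if l = a then x else if l = b then y else 0)"
  shows "cinner X v (op_apply X r v) =
    cnj x * r (a, a) * x + cnj x * r (a, b) * y + cnj y * r (b, a) * x + cnj y * r (b, b) * y"
proof -
  have *: "(\<Sum>l\<in>X. f l) = f a + f b" if "\<And>l. l \<noteq> a \<Longrightarrow> l \<noteq> b \<Longrightarrow> f l = 0" for f :: "'a \<Rightarrow> complex"
  proof -
    have "(\<Sum>l\<in>X. f l) = (\<Sum>l\<in>{a, b}. f l)"
      using assms(1-3) that by (intro sum.mono_neutral_right) auto
    then show ?thesis using \<open>a \<noteq> b\<close> by simp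
  qed
  have app: "op_apply X r v j = r (j, a) * x + r (j, b) * y" for j
    unfolding op_apply_def by (subst *) (use \<open>a \<noteq> b\<close> in \<open>auto simp: v_def\<close>)
  show ?thesis
    unfolding cinner_def app by (subst *) (use \<open>a \<noteq> b\<close> in \<open>auto simp: v_def algebra_simps\<close>)
qed

lemma op_positive_diag:
  assumes "finite X" "op_positive X r" "i \<in> X"
  shows "r (i, i) \<in> \<real>\<^sub>\<ge>\<^sub>0"
proof -
  define v where "v = (\<lambda>l. if l = i then 1 else 0 :: complex)"
  have "cinner X v (op_apply X r v) = r (i, i)"
    using assms by (simp add: cinner_def op_apply_def v_def if_distrib if_distribR cong: if_cong)
  moreover have "v \<in> ell2 X" using assms by (auto simp: v_def ell2_def)
  ultimately show ?thesis using assms(2) by (metis op_positive_def)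
qed

lemma op_positive_pair:
  assumes "finite X" "op_positive X r" "a \<in> X" "b \<in> X" "a \<noteq> b"
  shows "cnj x * r (a, a) * x + cnj x * r (a, b) * y + cnj y * r (b, a) * x + cnj y * r (b, b) * y
    \<in> \<real>\<^sub>\<ge>\<^sub>0"
proof -
  have "(\<lambda>l. if l = a then x else if l = b then y else 0) \<in> ell2 X"
    using assms by (auto simp: ell2_def)
  then show ?thesis
    using assms(2) unfolding op_positive_def cinner_op_apply_pair[OF assms(1,3-5), symmetric] by blast
qed

text \<open>Polarization: since the form is real, the test coefficients \<open>1, 1\<close> compare
  the imaginary parts of \<open>r (a, b)\<close> and \<open>r (b, a)\<close>, and
  \<open>1, \<i>\<close> their real parts.\<close>

lemma op_positive_hermitian:
  assumes "finite X" "op_positive X r" "a \<in> X" "b \<in> X"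
  shows "r (b, a) = cnj (r (a, b))"
proof (cases "a = b")
  case True
  with op_positive_diag[OF assms(1,2,3)] show ?thesis
    by (simp add: complex_nonneg_Reals_iff complex_eq_iff)
next
  case False
  note pos = op_positive_pair[OF assms False]
  have "Im (r (a, a)) = 0" "Im (r (b, b)) = 0"
    using op_positive_diag[OF assms(1,2)] assms(3,4) by (auto simp: complex_nonneg_Reals_iff)
  with pos[of 1 1] pos[of 1 \<i>] show ?thesis
    by (simp add: complex_nonneg_Reals_iff complex_eq_iff)
qed

text \<open>With \<open>r (a, a) = 0\<close> the form at the coefficients
  \<open>- s * r (a, b)\<close> and \<open>1\<close> is affine in the real number \<open>s\<close>,
  with slope minus twice the squared modulus of \<open>r (a, b)\<close>. Being nonnegative for all
  \<open>s\<close>, it has slope zero.\<close>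

lemma op_positive_diag_zero:
  assumes "finite X" "op_positive X r" "a \<in> X" "b \<in> X" "r (a, a) = 0"
  shows "r (a, b) = 0"
proof (cases "a = b")
  case False
  note pos = op_positive_pair[OF assms(1-4) False]
  define n where "n = (norm (r (a, b)))\<^sup>2"
  have herm: "r (b, a) = cnj (r (a, b))" by (rule op_positive_hermitian[OF assms(1-4)])
  have "2 * s * n \<le> Re (r (b, b))" for s
  proof -
    have "complex_of_real n = r (a, b) * cnj (r (a, b))"
      unfolding n_def by (simp add: complex_norm_square del: of_real_power)
    then have n: "n = Re (r (a, b)) * Re (r (a, b)) + Im (r (a, b)) * Im (r (a, b))"
      by (simp add: complex_eq_iff)
    show ?thesis
      using pos[of "- of_real s * r (a, b)" 1]
      unfolding n by (simp add: complex_nonneg_Reals_iff assms(5) herm algebra_simps)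
  qed
  \<comment> \<open>For nonzero \<open>n\<close> this \<open>s\<close> makes the left side exceed
    the right side by 1.\<close>
  from this[of "(Re (r (b, b)) + 1) / (2 * n)"] have "n = 0"
    by (cases "n = 0") auto
  then show ?thesis by (simp add: n_def)
qed (use assms in auto)

text \<open>Cholesky decomposition: each step splits off the row of one index, and completing the
  square shows that the Schur complement is again positive.\<close>

lemma op_positive_factor:
  assumes "finite X" "r \<in> lin_ops X X" "op_positive X r"
  shows "\<exists>k\<in>lin_ops X X. r = op_comp X (op_adj k) k"
  using assms
proof (induction X arbitrary: r)
  case empty
  then show ?case by (auto simp: lin_ops_iff fun_eq_iff)
next
  case (insert i Y)
  let ?X = "insert i Y"
  have X: "finite ?X" "i \<in> ?X" using insert by auto
  note r = insert.prems(1) and pos = insert.prems(2)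
  obtain d where d: "r (i, i) = of_real d" "d \<ge> 0"
    using op_positive_diag[OF X(1) pos X(2)] by (auto elim: nonneg_Reals_cases)
  have herm: "r (b, a) = cnj (r (a, b))" for a b
    using op_positive_hermitian[OF X(1) pos, of a b] lin_ops_outside[OF r]
    by (cases "a \<in> ?X \<and> b \<in> ?X") (auto simp del: insert_iff)
  have zero: "r (i, b) = 0" if "d = 0" for b
    using op_positive_diag_zero[OF X(1) pos X(2), of b] lin_ops_outside[OF r] d that
    by (cases "b \<in> ?X") (auto simp del: insert_iff)
  \<comment> \<open>The Schur complement. If \<open>d = 0\<close>, the quotient is 0 by convention,
    and row \<open>i\<close> is zero by \<open>zero\<close>, so the same formula serves both
    cases.\<close>
  define r' where "r' = (\<lambda>(a, b). r (a, b) - r (a, i) * r (i, b) / of_real d)"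
  have "r' \<in> lin_ops Y Y"
  proof -
    have "r' (a, b) = 0" if "a \<notin> Y \<or> b \<notin> Y" for a b
    proof (cases "d = 0")
      case True
      then have "r (a, i) = 0" "r (i, b) = 0" "a = i \<Longrightarrow> r (a, b) = 0" "b = i \<Longrightarrow> r (a, b) = 0"
        using zero[OF True] herm[of a i] by auto
      then show ?thesis using that lin_ops_outside[OF r, of a b] by (auto simp: r'_def)
    next
      case False
      then show ?thesis
        using that lin_ops_outside[OF r, of a b] lin_ops_outside[OF r, of a i] lin_ops_outside[OF r, of i b]
        by (cases "a = i"; cases "b = i") (auto simp: r'_def d(1))
    qed
    then show ?thesis by (auto simp: lin_ops_iff)
  qed
  moreover have "op_positive Y r'"
    unfolding op_positive_def
  proof
    fix v :: "'a \<Rightarrow> complex" assume v: "v \<in> ell2 Y"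
    \<comment> \<open>The coefficient \<open>- c\<close> at \<open>i\<close> completes the square:
      the form of \<open>r\<close> at \<open>w\<close> is the form of \<open>r'\<close> at
      \<open>v\<close>. For \<open>d = 0\<close> the quotient gives \<open>c = 0\<close>.\<close>
    define c where "c = (\<Sum>j\<in>Y. r (i, j) * v j) / of_real d"
    define w where "w = v(i := - c)"
    have S: "(\<Sum>j\<in>Y. r (i, j) * v j) = c * of_real d"
      using zero by (cases "d = 0") (auto simp: c_def)
    have S': "(\<Sum>j\<in>Y. cnj (v j) * r (j, i)) = cnj c * of_real d"
      using arg_cong[OF S, of cnj] by (simp add: herm[of _ i] mult.commute)
    have wv: "w j = v j" if "j \<in> Y" for j using that insert by (auto simp: w_def)
    have eqs: "(\<Sum>j\<in>Y. r (i, j) * w j) = c * of_real d" "(\<Sum>j\<in>Y. cnj (w j) * r (j, i)) = cnj c * of_real d"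
      "cinner Y w (op_apply Y r w) = cinner Y v (op_apply Y r v)"
      unfolding S[symmetric] S'[symmetric] cinner_def op_apply_def
      by (simp_all add: wv cong: sum.cong)
    have "cinner ?X w (op_apply ?X r w) = cinner Y v (op_apply Y r v) - cnj c * c * of_real d"
      unfolding cinner_op_apply_insert[OF insert.hyps] eqs d(1)
      by (simp add: w_def)
    also have "\<dots> = cinner Y v (op_apply Y r' v)"
    proof -
      have app: "op_apply Y r' v a = op_apply Y r v a - r (a, i) * c" for a
        by (simp add: op_apply_def r'_def c_def algebra_simps sum_subtractf sum_distrib_left sum_divide_distrib)
      have "cinner Y v (op_apply Y r' v) =
          cinner Y v (op_apply Y r v) - (\<Sum>j\<in>Y. cnj (v j) * r (j, i)) * c"
        unfolding cinner_def app by (simp add: algebra_simps sum_subtractf sum_distrib_left)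
      then show ?thesis by (simp add: S' mult_ac)
    qed
    moreover have "w \<in> ell2 ?X" using v by (auto simp: w_def ell2_def)
    ultimately show "cinner Y v (op_apply Y r' v) \<in> \<real>\<^sub>\<ge>\<^sub>0"
      using pos unfolding op_positive_def by metis
  qed
  ultimately obtain k' where k': "k' \<in> lin_ops Y Y" "r' = op_comp Y (op_adj k') k'"
    using insert.IH by blast
  \<comment> \<open>The row at \<open>i\<close> contributes exactly the rank-one term subtracted in
    \<open>r'\<close>; for \<open>d = 0\<close> both are zero.\<close>
  define k where "k = (\<lambda>(a, b). if a = i then r (i, b) / of_real (sqrt d) else k' (a, b))"
  have "op_comp ?X (op_adj k) k (a, b) = r (a, b)" for a b
  proof -
    have "op_comp ?X (op_adj k) k (a, b) =
        cnj (r (i, a)) * r (i, b) / (of_real (sqrt d) * of_real (sqrt d)) + op_comp Y (op_adj k') k' (a, b)"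
      using insert.hyps by (auto simp: k_def intro!: sum.cong)
    also have "\<dots> = r (a, b)"
    proof -
      have "complex_of_real (sqrt d) * of_real (sqrt d) = of_real d"
        using d by (simp flip: of_real_mult)
      then show ?thesis
        unfolding k'(2)[symmetric] by (simp add: r'_def herm[of i a])
    qed
    finally show ?thesis .
  qed
  moreover have "k \<in> lin_ops ?X ?X"
    using r k'(1) insert.hyps by (auto simp: k_def lin_ops_iff)
  ultimately show ?case by (intro bexI[of _ k]) (auto simp: fun_eq_iff)
qed

lemma op_positive_adj:
  assumes "finite X" "r \<in> lin_ops X X" "op_positive X r"
  shows "op_adj r = r"
  using op_positive_factor[OF assms] by (auto simp: op_adj_comp)

text \<open>Factor \<open>r\<close> and \<open>s\<close> as adjoint squares of \<open>k\<close> and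
  \<open>l\<close>. The inner product is then the squared norm of \<open>k\<close> times
  \<open>\<psi>\<close> times \<open>op_adj l\<close>, and if this product vanishes, so does
  \<open>r\<close> times \<open>\<psi>\<close> times \<open>s\<close>. Thus zero probability yields
  an operator equation.\<close>

lemma cinner_positive_tensor:
  assumes fin: "finite A" "finite B"
    and r: "r \<in> lin_ops A A" "op_positive A r" and s: "s \<in> lin_ops B B" "op_positive B s"
    and \<psi>: "\<psi> \<in> lin_ops B A"
  shows "cinner (A \<times> B) \<psi> (op_comp B (op_comp A r \<psi>) s) \<in> \<real>\<^sub>\<ge>\<^sub>0"
    and "cinner (A \<times> B) \<psi> (op_comp B (op_comp A r \<psi>) s) = 0 \<Longrightarrow> op_comp B (op_comp A r \<psi>) s = 0"
proof -
  obtain k where k: "k \<in> lin_ops A A" "r = op_comp A (op_adj k) k"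
    using op_positive_factor[OF fin(1) r] by blast
  obtain l where l: "l \<in> lin_ops B B" "s = op_comp B (op_adj l) l"
    using op_positive_factor[OF fin(2) s] by blast
  define w where "w = op_comp B (op_comp A k \<psi>) (op_adj l)"
  have w: "w \<in> lin_ops B A"
    unfolding w_def by (intro op_comp_lin_ops[where Y = B] op_comp_lin_ops[where Y = A] op_adj_lin_ops k l \<psi>)
  have eq: "op_comp B (op_comp A r \<psi>) s = op_comp A (op_adj k) (op_comp B w l)"
    unfolding k(2) l(2) w_def by (simp flip: op_comp_assoc)
  have c: "cinner (A \<times> B) \<psi> (op_comp B (op_comp A r \<psi>) s) = cinner (A \<times> B) w w"
    unfolding eq cinner_op_adj_left by (subst cinner_op_adj_right) (simp add: w_def)
  show "cinner (A \<times> B) \<psi> (op_comp B (op_comp A r \<psi>) s) \<in> \<real>\<^sub>\<ge>\<^sub>0"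
    unfolding c by (rule cinner_self_nonneg)
  assume "cinner (A \<times> B) \<psi> (op_comp B (op_comp A r \<psi>) s) = 0"
  then have "w = 0"
    using fin w by (intro lin_ops_eqI[of _ B A]) (auto simp: c cinner_self_eq_0_iff lin_ops_iff)
  then show "op_comp B (op_comp A r \<psi>) s = 0" by (simp add: eq)
qed

text \<open>Induction over the columns of \<open>M\<close>: the columns of \<open>U\<close>, the
  product of \<open>M\<close> and \<open>C\<close>, form an orthonormal basis of the span of the
  columns of \<open>M\<close> indexed by \<open>B\<close>. Keeping the coefficients \<open>C\<close>
  records that \<open>U\<close> factors through \<open>M\<close>, which later makes the range of
  \<open>U\<close> invariant.\<close>

lemma gram_schmidt:
  fixes M :: "'a \<times> 'b \<Rightarrow> complex"
  assumes "finite A" "finite B" and M: "\<And>a b. a \<notin> A \<Longrightarrow> M (a, b) = 0"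
  shows "\<exists>(H :: 'h::infinite set) C. finite H \<and> C \<in> lin_ops H B \<and>
    op_comp A (op_adj (op_comp B M C)) (op_comp B M C) = op_id H \<and>
    (\<forall>b\<in>B. \<forall>a. op_comp H (op_comp B M C) (op_comp A (op_adj (op_comp B M C)) M) (a, b) = M (a, b))"
  using assms(2)
proof (induction B)
  case empty
  show ?case by (rule exI[of _ "{}"], rule exI[of _ 0]) (auto simp: lin_ops_iff fun_eq_iff)
next
  case (insert b B)
  then obtain H :: "'h set" and C where H: "finite H" and C: "C \<in> lin_ops H B"
    and orth: "op_comp A (op_adj (op_comp B M C)) (op_comp B M C) = op_id H"
    and proj: "\<forall>b\<in>B. \<forall>a. op_comp H (op_comp B M C) (op_comp A (op_adj (op_comp B M C)) M) (a, b) = M (a, b)"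
    by blast
  define U where "U = op_comp B M C"
  note orth = orth[folded U_def] and proj = proj[folded U_def]
  have Cb: "C (b, k) = 0" for k using C insert.hyps by (auto simp: lin_ops_iff)
  have U: "op_comp (insert b B) M C = U"
    using insert.hyps by (auto simp: U_def fun_eq_iff Cb)
  \<comment> \<open>\<open>w\<close> holds the coefficients of the new column along
    \<open>U\<close>, and \<open>r\<close> is its residual.\<close>
  define w where "w = (\<lambda>k. \<Sum>a\<in>A. cnj (U (a, k)) * M (a, b))"
  define r where "r = (\<lambda>a. M (a, b) - (\<Sum>k\<in>H. U (a, k) * w k))"
  have Mb: "M (a, b) = r a + (\<Sum>k\<in>H. U (a, k) * w k)" for a by (simp add: r_def)
  have orth': "(\<Sum>a\<in>A. cnj (U (a, h)) * U (a, k)) = (if h = k \<and> h \<in> H then 1 else 0)" for h k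
    using fun_cong[OF orth, of "(h, k)"] by auto
  have proj': "(\<Sum>k\<in>H. U (a, k) * (\<Sum>a'\<in>A. cnj (U (a', k)) * M (a', c))) = M (a, c)" if "c \<in> B" for a c
    using proj that by simp
  have Ur: "(\<Sum>a\<in>A. cnj (U (a, h)) * r a) = 0" for h
  proof (cases "h \<in> H")
    case True
    have "(\<Sum>a\<in>A. cnj (U (a, h)) * r a) = w h - (\<Sum>a\<in>A. \<Sum>k\<in>H. cnj (U (a, h)) * U (a, k) * w k)"
      by (simp add: r_def w_def algebra_simps sum_subtractf sum_distrib_left)
    also have "(\<Sum>a\<in>A. \<Sum>k\<in>H. cnj (U (a, h)) * U (a, k) * w k) = (\<Sum>k\<in>H. (\<Sum>a\<in>A. cnj (U (a, h)) * U (a, k)) * w k)"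
      by (subst sum.swap) (simp add: sum_distrib_right)
    also have "\<dots> = (\<Sum>k\<in>H. if h = k then w h else 0)"
      unfolding orth' by (intro sum.cong) auto
    finally show ?thesis using True H by simp
  next
    case False
    then have "C (c, h) = 0" for c using C by (auto simp: lin_ops_iff)
    then show ?thesis by (simp add: U_def)
  qed
  have rU: "(\<Sum>a\<in>A. cnj (r a) * U (a, h)) = 0" for h
    using arg_cong[OF Ur[of h], of cnj] by (simp add: mult.commute)
  have r_out: "r a = 0" if "a \<notin> A" for a
    using M[OF that] by (simp add: r_def U_def)
  show ?case
  proof (cases "\<forall>a. r a = 0")
    \<comment> \<open>The new column already lies in the range of \<open>U\<close>, so no basis
      vector is added.\<close>
    case True
    have "op_comp H U (op_comp A (op_adj U) M) (a, c) = M (a, c)" if "c \<in> insert b B" for a c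
    proof (cases "c = b")
      case True
      then show ?thesis using Mb[of a] \<open>\<forall>a. r a = 0\<close> by (simp add: w_def)
    next
      case False
      then show ?thesis using that proj by blast
    qed
    then show ?thesis
      using H C orth U by (intro exI[of _ H] exI[of _ C]) (auto simp: lin_ops_iff)
  next
    case False
    obtain h where h: "h \<notin> H" using H ex_new_if_finite[OF infinite_UNIV] by blast
    define n where "n = sqrt (\<Sum>a\<in>A. (norm (r a))\<^sup>2)"
    have rr: "(\<Sum>a\<in>A. cnj (r a) * r a) = of_real n * of_real n"
      using cinner_self[of A r] by (simp add: cinner_def n_def sum_nonneg flip: of_real_mult)
    have n: "n \<noteq> 0"
    proof
      assume "n = 0"
      then have "cinner A r r = 0" using rr by (simp add: cinner_def)
      then show False using False r_out cinner_self_eq_0_iff[OF assms(1)] by blast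
    qed
    \<comment> \<open>The residual is \<open>M\<close> applied to the unit vector at
      \<open>b\<close> minus \<open>C w\<close>. Dividing by its norm \<open>n\<close> gives the
      coefficients of the new basis vector, which gets the fresh index \<open>h\<close>.\<close>
    define C' where "C' = (\<lambda>(c, k). if k = h then (if c = b then 1 else - (\<Sum>l\<in>H. C (c, l) * w l)) / of_real n
      else C (c, k))"
    define U' where "U' = (\<lambda>(a, k). if k = h then r a / of_real n else U (a, k))"
    have "op_comp (insert b B) M C' (a, k) = U' (a, k)" for a k
    proof (cases "k = h")
      case True
      have "(\<Sum>c\<in>B. M (a, c) * (\<Sum>l\<in>H. C (c, l) * w l)) = (\<Sum>l\<in>H. U (a, l) * w l)"
        by (simp add: U_def sum_distrib_left sum_distrib_right mult.assoc) (rule sum.swap)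
      moreover have "op_comp (insert b B) M C' (a, k) =
          (M (a, b) - (\<Sum>c\<in>B. M (a, c) * (\<Sum>l\<in>H. C (c, l) * w l))) / of_real n"
      proof -
        have "(\<Sum>c\<in>B. M (a, c) * C' (c, h)) = (\<Sum>c\<in>B. - (M (a, c) * (\<Sum>l\<in>H. C (c, l) * w l)) / of_real n)"
          using insert.hyps by (intro sum.cong) (auto simp: C'_def)
        then show ?thesis
          using True insert.hyps
          by (simp add: diff_divide_distrib sum_negf flip: sum_divide_distrib) (simp add: C'_def)
      qed
      ultimately show ?thesis using True by (simp add: r_def U'_def)
    next
      case False
      then have "op_comp (insert b B) M C' (a, k) = op_comp (insert b B) M C (a, k)"
        by (simp add: C'_def)
      with False show ?thesis by (simp add: U U'_def del: op_comp_apply)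
    qed
    then have U': "op_comp (insert b B) M C' = U'" by (auto simp: fun_eq_iff)
    have "C' \<in> lin_ops (insert h H) (insert b B)"
      using C by (auto simp: lin_ops_iff C'_def)
    moreover have "op_comp A (op_adj U') U' = op_id (insert h H)"
    proof -
      have "op_comp A (op_adj U') U' (k, l) = op_id (insert h H) (k, l)" for k l
      proof -
        have "(\<Sum>a\<in>A. cnj (U' (a, k)) * U' (a, l)) =
          (if k = h then (if l = h then (\<Sum>a\<in>A. cnj (r a) * r a) / (of_real n * of_real n)
              else (\<Sum>a\<in>A. cnj (r a) * U (a, l)) / of_real n)
           else if l = h then (\<Sum>a\<in>A. cnj (U (a, k)) * r a) / of_real n
           else (\<Sum>a\<in>A. cnj (U (a, k)) * U (a, l)))"
          by (simp add: U'_def sum_divide_distrib)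
        also have "\<dots> = op_id (insert h H) (k, l)"
          unfolding Ur rU rr orth' using n h by auto
        finally show ?thesis by simp
      qed
      then show ?thesis by (auto simp: fun_eq_iff)
    qed
    moreover have "op_comp (insert h H) U' (op_comp A (op_adj U') M) (a, c) = M (a, c)"
      if "c \<in> insert b B" for a c
    proof -
      have "op_comp (insert h H) U' (op_comp A (op_adj U') M) (a, c) =
          (\<Sum>k\<in>H. U (a, k) * (\<Sum>a'\<in>A. cnj (U (a', k)) * M (a', c))) +
          r a / of_real n * ((\<Sum>a'\<in>A. cnj (r a') * M (a', c)) / of_real n)"
      proof -
        have "(\<Sum>k\<in>H. U' (a, k) * (\<Sum>a'\<in>A. cnj (U' (a', k)) * M (a', c))) =
            (\<Sum>k\<in>H. U (a, k) * (\<Sum>a'\<in>A. cnj (U (a', k)) * M (a', c)))"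
          using h by (intro sum.cong refl) (auto simp: U'_def)
        then show ?thesis
          using H h by (simp add: sum_divide_distrib) (simp add: U'_def)
      qed
      \<comment> \<open>Against \<open>r\<close>, the column \<open>b\<close> has inner product
        \<open>n\<close> squared, which restores the residual; an old column lies in the range of
        \<open>U\<close> and is orthogonal to \<open>r\<close>.\<close>
      also have "\<dots> = M (a, c)"
      proof (cases "c = b")
        case True
        have "(\<Sum>a'\<in>A. cnj (r a') * M (a', b)) =
            (\<Sum>a'\<in>A. cnj (r a') * r a') + (\<Sum>a'\<in>A. \<Sum>k\<in>H. cnj (r a') * U (a', k) * w k)"
          by (simp add: Mb algebra_simps sum.distrib sum_distrib_left)
        also have "(\<Sum>a'\<in>A. \<Sum>k\<in>H. cnj (r a') * U (a', k) * w k) = (\<Sum>k\<in>H. (\<Sum>a'\<in>A. cnj (r a') * U (a', k)) * w k)"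
          by (subst sum.swap) (simp add: sum_distrib_right)
        finally have "(\<Sum>a'\<in>A. cnj (r a') * M (a', b)) = of_real n * of_real n" by (simp add: rr rU)
        then have "(\<Sum>a'\<in>A. cnj (r a') * M (a', c)) / of_real n = of_real n"
          using n True by simp
        moreover have "(\<Sum>k\<in>H. U (a, k) * (\<Sum>a'\<in>A. cnj (U (a', k)) * M (a', c))) = (\<Sum>k\<in>H. U (a, k) * w k)"
          using True by (simp add: w_def)
        ultimately show ?thesis
          using n True by (simp add: Mb[of a])
      next
        case False
        with that have c: "c \<in> B" by simp
        define z where "z = (\<lambda>k. \<Sum>a'\<in>A. cnj (U (a', k)) * M (a', c))"
        have Mc: "M (a', c) = (\<Sum>k\<in>H. U (a', k) * z k)" for a'
          using proj'[OF c] by (simp add: z_def)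
        have "(\<Sum>a'\<in>A. cnj (r a') * M (a', c)) = (\<Sum>a'\<in>A. \<Sum>k\<in>H. cnj (r a') * U (a', k) * z k)"
          by (simp add: Mc sum_distrib_left mult.assoc)
        also have "\<dots> = (\<Sum>k\<in>H. (\<Sum>a'\<in>A. cnj (r a') * U (a', k)) * z k)"
          by (subst sum.swap) (simp add: sum_distrib_right)
        finally show ?thesis by (simp add: rU proj'[OF c])
      qed
      finally show ?thesis .
    qed
    ultimately show ?thesis
      using H by (intro exI[of _ "insert h H"] exI[of _ C']) (auto simp: U' simp del: op_comp_apply)
  qed
qed


text \<open>All answers, and already the winning ones, have total probability 1. The losing
  probabilities are nonnegative with sum 0, so each is 0, and by
  \<open>cinner_positive_tensor\<close> the operator itself vanishes.\<close>

lemma losing_answers: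
  assumes T: "finite T" and win: "winning_strategy G T A B \<psi> E E'"
    and g: "g \<in> pverts G" "g' \<in> pverts G" and t: "t \<in> T" "t' \<in> T"
    and lose: "\<not> coloring_win G g g' t t'"
  shows "op_comp B (op_comp A (E g t) \<psi>) (op_trans (E' g' t')) = 0"
proof -
  have strat: "entangled_strategy G T A B \<psi> E E'"
    using win by (simp add: winning_strategy_def)
  have fin: "finite A" "finite B" and psi: "\<psi> \<in> lin_ops B A"
    and povm: "\<And>g. g \<in> pverts G \<Longrightarrow> povm T A (E g)" "\<And>g. g \<in> pverts G \<Longrightarrow> povm T B (E' g)"
    using strat by (auto simp: entangled_strategy_def lin_ops_def)
  let ?p = "\<lambda>(t, t'). answer_prob A B \<psi> E E' g g' t t'"
  let ?W = "{(t, t') \<in> T \<times> T. coloring_win G g g' t t'}"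
  note tensor = cinner_positive_tensor[OF fin _ _ op_trans_lin_ops op_positive_trans psi]
  have nonneg: "?p x \<in> \<real>\<^sub>\<ge>\<^sub>0" if "x \<in> T \<times> T" for x
    using that povm g by (auto simp: answer_prob_eq povm_def intro!: tensor(1))
  have "sum ?p (T \<times> T) = sum ?p (T \<times> T - ?W) + sum ?p ?W"
    using T by (intro sum.subset_diff) auto
  then have "sum ?p (T \<times> T - ?W) = 0"
    using win g sum_answer_prob[OF strat g] by (simp add: winning_strategy_def)
  then have "(\<Sum>x\<in>T \<times> T - ?W. Re (?p x)) = 0"
    by (metis Re_sum zero_complex.simps(1))
  moreover have "Re (?p x) \<ge> 0" if "x \<in> T \<times> T" for x
    using nonneg[OF that] unfolding complex_nonneg_Reals_iff by blast
  ultimately have "\<forall>x\<in>T \<times> T - ?W. Re (?p x) = 0"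
    using T by (subst (asm) sum_nonneg_eq_0_iff) (blast intro: finite_cartesian_product)+
  moreover have "(t, t') \<in> T \<times> T - ?W" using t lose by simp
  ultimately have "Re (?p (t, t')) = 0" by (rule bspec)
  then have "?p (t, t') = 0"
    using nonneg[of "(t, t')"] t by (simp add: complex_nonneg_Reals_iff complex_eq_iff)
  then show ?thesis
    using povm g t by (intro tensor(2)) (auto simp: answer_prob_eq povm_def)
qed

lemma projective_coloring_of_winning_strategy:
  assumes G: "pair_graph G" and T: "finite T" and win: "winning_strategy G T A B \<psi> E E'"
  shows "\<exists>(H :: 'h::infinite set) P. finite H \<and> H \<noteq> {} \<and> projective_coloring G T H P"
proof -
  have strat: "entangled_strategy G T A B \<psi> E E'"
    using win by (simp add: winning_strategy_def)
  have fin: "finite A" "finite B" and psi: "\<psi> \<in> lin_ops B A" and norm: "cinner (A \<times> B) \<psi> \<psi> = 1"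
    and povm: "\<And>g. g \<in> pverts G \<Longrightarrow> povm T A (E g)" "\<And>g. g \<in> pverts G \<Longrightarrow> povm T B (E' g)"
    using strat by (auto simp: entangled_strategy_def lin_ops_def)
  define F where "F = (\<lambda>g t. op_trans (E' g t))"
  have E: "E g t \<in> lin_ops A A" "op_adj (E g t) = E g t" if "g \<in> pverts G" "t \<in> T" for g t
    using povm(1)[OF that(1)] that(2) op_positive_adj[OF fin(1)] by (auto simp: povm_def)
  have F: "F g t \<in> lin_ops B B" if "g \<in> pverts G" "t \<in> T" for g t
    using povm(2)[OF that(1)] that(2) by (auto simp: povm_def F_def op_trans_lin_ops)
  have sum_E: "(\<Sum>t\<in>T. E g t) = op_id A" and sum_F: "(\<Sum>t\<in>T. F g t) = op_id B" if "g \<in> pverts G" for g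
    using povm[OF that] by (auto simp: povm_def F_def simp flip: op_trans_sum)
  have lose: "op_comp B (op_comp A (E g t) \<psi>) (F g' t') = 0"
    if "g \<in> pverts G" "g' \<in> pverts G" "t \<in> T" "t' \<in> T" "\<not> coloring_win G g g' t t'" for g g' t t'
    unfolding F_def using losing_answers[OF T win] that by blast
  \<comment> \<open>Insert the sum of the \<open>F g t'\<close> on the left side and the sum of the
    \<open>E g t'\<close> on the right side. Disagreeing answers to equal questions lose, so both
    sides reduce to the same term at \<open>t\<close>.\<close>
  have swap: "op_comp A (E g t) \<psi> = op_comp B \<psi> (F g t)" if g: "g \<in> pverts G" and t: "t \<in> T" for g t
  proof -
    have lose': "op_comp B (op_comp A (E g t1) \<psi>) (F g t2) = 0" if "t1 \<in> T" "t2 \<in> T" "t1 \<noteq> t2" for t1 t2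
      using lose g that by (auto simp: coloring_win_def)
    have "op_comp A (E g t) \<psi> = op_comp B (op_comp A (E g t) \<psi>) (\<Sum>t'\<in>T. F g t')"
      using fin g t E psi by (simp add: sum_F op_comp_id_right[where Y = A] op_comp_lin_ops[where Y = A])
    also have "\<dots> = (\<Sum>t'\<in>T. if t' = t then op_comp B (op_comp A (E g t) \<psi>) (F g t) else 0)"
      unfolding op_comp_sum_right using lose' t by (intro sum.cong) auto
    also have "\<dots> = (\<Sum>t'\<in>T. if t' = t then op_comp B (op_comp A (E g t') \<psi>) (F g t) else 0)"
      by (intro sum.cong) auto
    also have "\<dots> = op_comp B (op_comp A (\<Sum>t'\<in>T. E g t') \<psi>) (F g t)"
      unfolding op_comp_sum_left using lose' t by (intro sum.cong) auto
    finally show ?thesis using fin g psi by (simp add: sum_E op_comp_id_left[where X = B])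
  qed
  obtain H :: "'h set" and C where H: "finite H" and C: "C \<in> lin_ops H B"
    and orth: "op_comp A (op_adj (op_comp B \<psi> C)) (op_comp B \<psi> C) = op_id H"
    and proj: "\<forall>b\<in>B. \<forall>a. op_comp H (op_comp B \<psi> C) (op_comp A (op_adj (op_comp B \<psi> C)) \<psi>) (a, b) = \<psi> (a, b)"
    using gram_schmidt[OF fin, of \<psi>] psi by (auto simp: lin_ops_iff)
  define U where "U = op_comp B \<psi> C"
  note orth = orth[folded U_def] and proj = proj[folded U_def]
  have U: "U \<in> lin_ops H A" unfolding U_def by (rule op_comp_lin_ops[OF psi C])
  have proj: "op_comp H U (op_comp A (op_adj U) \<psi>) = \<psi>"
    using proj by (intro lin_ops_eqI[of _ B A] psi op_comp_lin_ops[OF U] op_comp_lin_ops[OF op_adj_lin_ops[OF U]])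
      (auto simp del: op_comp_apply)
  \<comment> \<open>The columns of \<open>\<psi>\<close> lie in the range of \<open>U\<close>, and
    \<open>\<psi>\<close> is nonzero.\<close>
  have "H \<noteq> {}"
  proof
    assume "H = {}"
    then have "op_comp H U (op_comp A (op_adj U) \<psi>) = 0" by (auto simp: fun_eq_iff)
    then have "\<psi> = 0" unfolding proj .
    then show False using norm by simp
  qed
  \<comment> \<open>\<open>E g t\<close> maps the range of \<open>U\<close> into the range of
    \<open>\<psi>\<close>, whose vectors are fixed by the projection in \<open>proj\<close>.\<close>
  have EU: "op_comp A (E g t) U = op_comp B \<psi> (op_comp B (F g t) C)" if "g \<in> pverts G" "t \<in> T" for g t
    unfolding U_def using swap[OF that] by (simp add: op_comp_assoc)
  \<comment> \<open>After \<open>EU\<close> for the inner factor, a losing answer operator splits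
    off on the left.\<close>
  have EEU: "op_comp A (E g t) (op_comp A (E g' t') U) = 0"
    if "g \<in> pverts G" "g' \<in> pverts G" "t \<in> T" "t' \<in> T" "\<not> coloring_win G g g' t t'" for g g' t t'
    using lose[OF that] that by (simp add: EU op_comp_assoc)
  have "projective_coloring G T H (\<lambda>g t. op_comp A (op_adj U) (op_comp A (E g t) U))"
  proof (rule projective_coloring_compress[OF G fin(1) H U orth])
    show "op_comp H U (op_comp A (op_adj U) (op_comp A (E g t) U)) = op_comp A (E g t) U"
      if "g \<in> pverts G" "t \<in> T" for g t
    proof -
      have "op_comp H U (op_comp A (op_adj U) (op_comp B \<psi> k)) = op_comp B (op_comp H U (op_comp A (op_adj U) \<psi>)) k"
        for k :: "_ \<times> 'h \<Rightarrow> complex"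
        by (simp only: op_comp_assoc)
      then show ?thesis unfolding EU[OF that] proj .
    qed
  qed (use E sum_E EEU pair_graph_arc_verts[OF G] in \<open>auto simp: coloring_win_def\<close>)
  with H \<open>H \<noteq> {}\<close> show ?thesis by blast
qed

section \<open>Quantum families\<close>

lemma cspan_linear:
  assumes "v \<in> cspan S" "csubspace D"
    and "\<And>x y. L (x + y) = L x + L y" "\<And>c x. L (cscale c x) = cscale c (L x)"
    and "\<And>x. x \<in> S \<Longrightarrow> L x \<in> D"
  shows "L v \<in> D"
proof -
  have "L 0 = 0" using assms(4)[of 0 0] by (simp add: cscale_def zero_fun_def)
  then have "csubspace {v. L v \<in> D}"
    using assms(2-4) by (auto simp: cfun.subspace_def)
  with assms(1,5) show ?thesis by (auto intro: cfun.span_induct[of v S "\<lambda>v. L v \<in> D"])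
qed

lemma csubspace_image_linear:
  assumes "csubspace S" "\<And>x y. L (x + y) = L x + L y" "\<And>c x. L (cscale c x) = cscale c (L x)"
  shows "csubspace (L ` S)"
proof -
  have "L 0 = 0" using assms(3)[of 0 0] by (simp add: cscale_def zero_fun_def)
  then show ?thesis using assms(1) unfolding cfun.subspace_def
    by (auto simp flip: assms(2,3))
qed

lemma qset_prod_classical_iff:
  "Q \<in> qset_prod (classical_qset V) \<X> \<longleftrightarrow> (\<exists>g\<in>V. \<exists>X\<in>\<X>. Q = {g} \<times> X)"
  by (auto simp: qset_prod_def classical_qset_def)

lemma qrel_compI:
  assumes "Y \<in> \<Y>" "s \<in> S Y Z" "r \<in> R X Y"
  shows "op_comp Y s r \<in> qrel_comp \<Y> S R X Z"
  unfolding qrel_comp_def using assms by (blast intro: cfun.span_base)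

lemma csubspace_qrel_id: "csubspace (qrel_id X Y)"
proof (cases "X = Y")
  case True
  have "csubspace (range (\<lambda>c. cscale c (op_id X)))"
    unfolding cfun.span_singleton[symmetric] by (rule cfun.subspace_span)
  then show ?thesis using True by (simp add: qrel_id_def full_SetCompr_eq)
qed (simp add: qrel_id_def cfun.subspace_def)

text \<open>The identification of the atom \<open>{g} \<times> X\<close> with \<open>X\<close>,
  applied to operators; it drops the one-dimensional tensor factor at \<open>g\<close>.\<close>

definition op_slice :: "'g \<Rightarrow> ('y \<times> ('g \<times> 'x) \<Rightarrow> complex) \<Rightarrow> ('y \<times> 'x \<Rightarrow> complex)" where
  "op_slice g r = (\<lambda>(j, i). r (j, (g, i)))"

lemma op_slice_apply [simp]: "op_slice g r (j, i) = r (j, (g, i))"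
  by (simp add: op_slice_def)

lemma op_slice_linear:
  "op_slice g (r + s) = op_slice g r + op_slice g s"
  "op_slice g (cscale c r) = cscale c (op_slice g r)"
  by (auto simp: fun_eq_iff cscale_def)

lemma op_slice_lin_ops: "r \<in> lin_ops ({g} \<times> X) Y \<Longrightarrow> op_slice g r \<in> lin_ops X Y"
  by (auto simp: lin_ops_iff)

lemma sum_singleton_Times: "(\<Sum>q\<in>{g} \<times> X. f q) = (\<Sum>x\<in>X. f (g, x))"
  by (rule sum.reindex_bij_witness[of _ "Pair g" snd]) auto

lemma op_comp_slice:
  "op_comp ({g} \<times> X) r (op_adj s) = op_comp X (op_slice g r) (op_adj (op_slice g s))"
  by (auto simp: fun_eq_iff sum_singleton_Times)

text \<open>The inclusion of \<open>\<ell>\<^sup>2({()}) \<otimes> \<ell>\<^sup>2(X)\<close> as the summand at \<open>g\<close>: it spans \<open>`g \<times> I\<close>.\<close>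

definition op_vertex :: "'g \<Rightarrow> 'x set \<Rightarrow> (('g \<times> 'x) \<times> (unit \<times> 'x) \<Rightarrow> complex)" where
  "op_vertex g X = (\<lambda>((h, x), (u, y)). if h = g \<and> x = y \<and> x \<in> X then 1 else 0)"

text \<open>Nonempty atoms determine their factors, so only one choice of factors enters the span.
  The identity relation vanishes off the diagonal and the point relation away from
  \<open>g\<close>.\<close>

lemma qrel_prod_vertex:
  fixes g g' :: 'g
  assumes "X \<noteq> {}" "X' \<noteq> {}" "k \<in> qrel_prod (classical_qrel {((), g)}) qrel_id ({()} \<times> X) ({g'} \<times> X')"
  shows "k = 0 \<or> (g' = g \<and> X' = X \<and> (\<exists>c. k = cscale c (op_vertex g X)))"
proof -
  define D where "D = (if g' = g \<and> X' = X then range (\<lambda>c. cscale c (op_vertex g X)) else {0})"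
  have "csubspace D"
    unfolding D_def cfun.span_singleton[symmetric] by (simp add: cfun.subspace_span)
  moreover have "op_tensor r1 r2 \<in> D"
    if prems: "{()} \<times> X = X1 \<times> X2" "{g'} \<times> X' = Y1 \<times> Y2"
      "r1 \<in> classical_qrel {((), g)} X1 Y1" "r2 \<in> qrel_id X2 Y2" for X1 X2 Y1 Y2 r1 r2
  proof -
    have [simp]: "X1 = {()}" "X2 = X" "Y1 = {g'}" "Y2 = X'"
      using prems(1,2) assms(1,2) by (auto simp: times_eq_iff)
    show ?thesis
    proof (cases "g' = g \<and> X' = X")
      case True
      then obtain c where c: "r2 = cscale c (op_id X)"
        using prems(4) by (auto simp: qrel_id_def)
      have "r1 \<in> lin_ops {()} {g}"
        using prems(3) True by (auto simp: classical_qrel_def)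
      then have "op_tensor r1 r2 = cscale (r1 (g, ()) * c) (op_vertex g X)"
        by (auto simp: fun_eq_iff op_tensor_def op_vertex_def cscale_def c lin_ops_iff)
      with True show ?thesis by (auto simp: D_def)
    next
      case False
      then have "r1 = 0 \<or> r2 = 0"
        using prems(3,4) by (auto simp: classical_qrel_def qrel_id_def split: if_splits)
      then have "op_tensor r1 r2 = 0" by (auto simp: op_tensor_def fun_eq_iff)
      with False show ?thesis by (auto simp: D_def)
    qed
  qed
  ultimately have "qrel_prod (classical_qrel {((), g)}) qrel_id ({()} \<times> X) ({g'} \<times> X') \<subseteq> D"
    unfolding qrel_prod_def by (intro cfun.span_minimal) auto
  with assms(3) show ?thesis by (auto simp: D_def split: if_splits)
qed

lemma op_vertex_in_qrel_prod:
  "op_vertex g X \<in> qrel_prod (classical_qrel {((), g)}) qrel_id ({()} \<times> X) ({g} \<times> X)"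
proof -
  define e where "e = (\<lambda>(h, u :: unit). if h = g then 1 else 0 :: complex)"
  have "op_vertex g X = op_tensor e (op_id X)"
    by (auto simp: op_vertex_def op_tensor_def e_def fun_eq_iff)
  moreover have "e \<in> classical_qrel {((), g)} {()} {g}"
    by (auto simp: e_def classical_qrel_def lin_ops_iff)
  moreover have "op_id X \<in> qrel_id X X"
    by (auto simp: qrel_id_def cscale_def intro!: exI[of _ 1])
  ultimately show ?thesis
    unfolding qrel_prod_def by (intro cfun.span_base) blast
qed

text \<open>Only the atom \<open>{g} \<times> X\<close> contributes to the composition, where
  precomposing with \<open>op_vertex g X\<close> merely relabels the input index. The span adds
  nothing, as a linear image of a subspace is a subspace.\<close>

lemma qfamily_member_eq:
  fixes F :: "('g \<times> 'x, 't) qrelation"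
  assumes \<X>: "quantum_set \<X>" and g: "g \<in> V" and X: "X \<in> \<X>"
    and F: "F ({g} \<times> X) Y \<subseteq> lin_ops ({g} \<times> X) Y" "csubspace (F ({g} \<times> X) Y)"
  shows "qfamily_member V \<X> F g X Y = op_slice g ` F ({g} \<times> X) Y"
proof -
  have atom: "finite X'" "X' \<noteq> {}" if "X' \<in> \<X>" for X'
    using \<X> that by (auto simp: quantum_set_def)
  \<comment> \<open>The relabeled operator still carries the unit index; the identification in
    \<open>qfamily_member\<close> removes it.\<close>
  define L where "L = (\<lambda>r :: 't \<times> ('g \<times> 'x) \<Rightarrow> complex. \<lambda>(j, (u :: unit, i)). r (j, (g, i)))"
  have L: "L (r + s) = L r + L s" "L (cscale c r) = cscale c (L r)" for r s c
    by (auto simp: L_def fun_eq_iff cscale_def)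
  have comp: "op_comp ({g} \<times> X) r (op_vertex g X) = L r" if "r \<in> F ({g} \<times> X) Y" for r
  proof -
    have "op_comp ({g} \<times> X) r (op_vertex g X) (k, (u, i)) = L r (k, (u, i))" for k u i
    proof -
      have "op_comp ({g} \<times> X) r (op_vertex g X) (k, (u, i)) = (\<Sum>x\<in>X. if x = i then r (k, (g, i)) else 0)"
        by (auto simp: op_vertex_def sum_singleton_Times intro!: sum.cong)
      also have "\<dots> = r (k, (g, i))"
        using atom(1)[OF X] that F(1) by (auto simp: lin_ops_iff subset_iff)
      finally show ?thesis by (simp add: L_def)
    qed
    then show ?thesis by (auto simp: fun_eq_iff)
  qed
  let ?R = "qrel_prod (classical_qrel {((), g)}) qrel_id"
  let ?C = "qrel_comp (qset_prod (classical_qset V) \<X>) F ?R ({()} \<times> X) Y"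
  have sub: "csubspace (L ` F ({g} \<times> X) Y)"
    by (rule csubspace_image_linear[OF F(2) L])
  have "?C = L ` F ({g} \<times> X) Y"
  proof
    show "?C \<subseteq> L ` F ({g} \<times> X) Y"
      unfolding qrel_comp_def
    proof (rule cfun.span_minimal[OF _ sub], clarify)
      fix Q s k assume Q: "Q \<in> qset_prod (classical_qset V) \<X>" and s: "s \<in> F Q Y"
        and k: "k \<in> ?R ({()} \<times> X) Q"
      obtain g' X' where Q': "X' \<in> \<X>" "Q = {g'} \<times> X'"
        using Q by (auto simp: qset_prod_classical_iff)
      from qrel_prod_vertex[OF atom(2)[OF X] atom(2)[OF Q'(1)] k[unfolded Q'(2)]]
      show "op_comp Q s k \<in> L ` F ({g} \<times> X) Y"
      proof
        assume "k = 0"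
        then show ?thesis using cfun.subspace_0[OF sub] by simp
      next
        assume "g' = g \<and> X' = X \<and> (\<exists>c. k = cscale c (op_vertex g X))"
        then obtain c where c: "k = cscale c (op_vertex g X)" "Q = {g} \<times> X" using Q' by blast
        then show ?thesis
          using s unfolding c op_comp_scale
          by (intro cfun.subspace_scale[OF sub]) (auto simp only: comp)
      qed
    qed
    show "L ` F ({g} \<times> X) Y \<subseteq> ?C"
    proof clarify
      fix s assume s: "s \<in> F ({g} \<times> X) Y"
      have "{g} \<times> X \<in> qset_prod (classical_qset V) \<X>"
        using g X by (auto simp: qset_prod_classical_iff)
      then have "op_comp ({g} \<times> X) s (op_vertex g X) \<in> ?C"
        by (intro qrel_compI s op_vertex_in_qrel_prod)
      then show "L s \<in> ?C" unfolding comp[OF s] .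
    qed
  qed
  then show ?thesis
    unfolding qfamily_member_def by (simp add: image_image L_def op_slice_def)
qed

section \<open>Disjointness of predicates as orthogonality of operators\<close>

lemma cinner_op_apply_singleton:
  "cinner X (op_apply {t} (op_adj r) y) (op_apply {t} (op_adj s) z) =
    cnj (y t) * z t * op_comp X r (op_adj s) (t, t)"
  by (simp add: cinner_def op_apply_def sum_distrib_left mult_ac)

lemma csubspace_cinner_zero:
  "csubspace {v. cinner X u v = 0}" "csubspace {u. cinner X u v = 0}"
proof -
  have add: "cinner X u (v + w) = cinner X u v + cinner X u w"
    "cinner X (u + w) v = cinner X u v + cinner X w v" for u v w
    by (simp_all add: cinner_def sum.distrib algebra_simps)
  have scale: "cinner X u (cscale c v) = c * cinner X u v"
    "cinner X (cscale c u) v = cnj c * cinner X u v" for u v c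
    by (simp_all add: cinner_def cscale_def sum_distrib_left algebra_simps)
  have "cinner X 0 v = 0" for v by (simp add: cinner_def)
  then show "csubspace {v. cinner X u v = 0}" "csubspace {u. cinner X u v = 0}"
    by (simp_all add: cfun.subspace_def add scale)
qed

text \<open>The atom at \<open>t\<close> is one-dimensional, so inner products of generators of the
  two inverse images are multiples of the single entry of \<open>op_comp X r (op_adj s)\<close>.
  Linearity extends orthogonality to the spans.\<close>

lemma qpred_disjoint_point_iff:
  fixes M M' :: "('x, 't) qrelation"
  assumes t: "t \<in> T" and M: "\<And>X. X \<in> \<X> \<Longrightarrow> M X {t} \<subseteq> lin_ops X {t}" "\<And>X. X \<in> \<X> \<Longrightarrow> M' X {t} \<subseteq> lin_ops X {t}"
  shows "qpred_disjoint \<X> (qpred_inv_image (classical_qset T) M (qpred_point t))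
      (qpred_inv_image (classical_qset T) M' (qpred_point t)) \<longleftrightarrow>
    (\<forall>X\<in>\<X>. \<forall>r\<in>M X {t}. \<forall>s\<in>M' X {t}. op_comp X r (op_adj s) = 0)"
    (is "?L \<longleftrightarrow> ?R")
proof
  define S where "S = (\<lambda>(M :: ('x, 't) qrelation) X. {op_apply Y (op_adj r) y | Y y r.
    Y \<in> classical_qset T \<and> y \<in> qpred_point t Y \<and> r \<in> M X Y})"
  have inv: "qpred_inv_image (classical_qset T) M (qpred_point t) X = cspan (S M X)" for M and X :: "'x set"
    by (simp add: qpred_inv_image_def S_def)
  {
    assume L: ?L
    show ?R
    proof (intro ballI)
      fix X r s assume X: "X \<in> \<X>" and rs: "r \<in> M X {t}" "s \<in> M' X {t}"
      define e where "e = (\<lambda>x. if x = t then 1 else 0 :: complex)"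
      have "e \<in> qpred_point t {t}" "{t} \<in> classical_qset T"
        using t by (auto simp: e_def qpred_point_def ell2_def classical_qset_def)
      then have "op_apply {t} (op_adj r) e \<in> S M X" "op_apply {t} (op_adj s) e \<in> S M' X"
        unfolding S_def using rs by blast+
      then have "cinner X (op_apply {t} (op_adj r) e) (op_apply {t} (op_adj s) e) = 0"
        using L X by (auto simp: qpred_disjoint_def inv intro: cfun.span_base)
      then have "op_comp X r (op_adj s) (t, t) = 0"
        unfolding cinner_op_apply_singleton by (simp add: e_def)
      moreover have "op_comp X r (op_adj s) \<in> lin_ops {t} {t}"
        using rs M[OF X] by (auto intro!: op_comp_lin_ops[where Y = X] op_adj_lin_ops)
      ultimately show "op_comp X r (op_adj s) = 0"
        by (intro lin_ops_eqI[of _ "{t}" "{t}"]) (auto simp: lin_ops_iff)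
    qed
  next
    assume R: ?R
    \<comment> \<open>Generators from points other than \<open>t\<close> are zero; they are written
      as coming from the zero operator at \<open>t\<close>.\<close>
    have gen: "\<exists>y r. r \<in> insert 0 (M X {t}) \<and> v = op_apply {t} (op_adj r) y"
      if v: "v \<in> S M X" for v M and X :: "'x set"
    proof -
      obtain t' y r where *: "v = op_apply {t'} (op_adj r) y" "y \<in> qpred_point t {t'}" "r \<in> M X {t'}"
        using v unfolding S_def classical_qset_def by blast
      show ?thesis
      proof (cases "t' = t")
        case False
        then have "v = op_apply {t} (op_adj 0) y" using * by (auto simp: qpred_point_def op_apply_def)
        then show ?thesis by blast
      qed (use * in blast)
    qed
    show ?L
      unfolding qpred_disjoint_def inv
    proof (intro ballI)
      fix X u v assume X: "X \<in> \<X>" and u: "u \<in> cspan (S M X)" and v: "v \<in> cspan (S M' X)"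
      have base: "cinner X a b = 0" if a: "a \<in> S M X" and b: "b \<in> S M' X" for a b
      proof -
        obtain y r where 1: "r \<in> insert 0 (M X {t})" "a = op_apply {t} (op_adj r) y" using gen[OF a] by blast
        obtain z s where 2: "s \<in> insert 0 (M' X {t})" "b = op_apply {t} (op_adj s) z" using gen[OF b] by blast
        have "op_comp X r (op_adj s) = 0" using 1(1) 2(1) R X by auto
        then show ?thesis unfolding 1 2 cinner_op_apply_singleton by simp
      qed
      have "cinner X a v = 0" if "a \<in> S M X" for a
        using v csubspace_cinner_zero(1) base[OF that] by (rule cfun.span_induct)
      with u csubspace_cinner_zero(2) show "cinner X u v = 0" by (rule cfun.span_induct)
    qed
  }
qed

text \<open>Each product of generators contains a factor \<open>op_comp X r (op_adj s)\<close> with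
  \<open>r\<close> from \<open>M\<close> and \<open>s\<close> from \<open>M'\<close>. The adjoint
  version holds since the second set of generators is closed under adjoints; it serves before
  self-adjointness of \<open>b\<close> is known.\<close>

lemma op_comp_span_zero:
  fixes M :: "('t \<times> 'x \<Rightarrow> complex) set"
  assumes "\<And>r s. r \<in> M \<Longrightarrow> s \<in> M' \<Longrightarrow> op_comp X r (op_adj s) = 0"
    and a: "a \<in> cspan {op_comp {t} (op_adj s) r | s r. s \<in> M \<and> r \<in> M}"
    and b: "b \<in> cspan {op_comp {t'} (op_adj s) r | s r. s \<in> M' \<and> r \<in> M'}"
  shows "op_comp X a b = 0" "op_comp X a (op_adj b) = 0"
proof -
  have gen: "op_comp X r b = 0 \<and> op_comp X r (op_adj b) = 0" if "r \<in> M" for r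
    using b
  proof (rule cfun.span_induct)
    show "csubspace {b. op_comp X r b = 0 \<and> op_comp X r (op_adj b) = 0}"
    proof -
      have "op_adj (b + c) = op_adj b + op_adj c" "op_adj (cscale d b) = cscale (cnj d) (op_adj b)"
        for b c :: "'x \<times> 'x \<Rightarrow> complex" and d
        by (auto simp: fun_eq_iff cscale_def)
      then show ?thesis by (auto simp: cfun.subspace_def op_comp_add op_comp_scale)
    qed
    fix b assume "b \<in> {op_comp {t'} (op_adj s) r | s r. s \<in> M' \<and> r \<in> M'}"
    then obtain s1 s2 where b: "b = op_comp {t'} (op_adj s1) s2" "s1 \<in> M'" "s2 \<in> M'" by blast
    have "op_comp X r (op_comp {t'} (op_adj s) s') = 0" if "s \<in> M'" for s s'
      using assms(1)[OF \<open>r \<in> M\<close> that] by (simp add: op_comp_assoc)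
    from this[OF b(2), of s2] this[OF b(3), of s1]
    show "op_comp X r b = 0 \<and> op_comp X r (op_adj b) = 0"
      unfolding b(1) op_adj_comp op_adj_adj by blast
  qed
  have "op_comp X a b = 0 \<and> op_comp X a (op_adj b) = 0"
    using a
  proof (rule cfun.span_induct)
    show "csubspace {a. op_comp X a b = 0 \<and> op_comp X a (op_adj b) = 0}"
      by (auto simp: cfun.subspace_def op_comp_add op_comp_scale)
    fix a assume "a \<in> {op_comp {t} (op_adj s) r | s r. s \<in> M \<and> r \<in> M}"
    then obtain s r where "a = op_comp {t} (op_adj s) r" "s \<in> M" "r \<in> M" by blast
    with gen show "op_comp X a b = 0 \<and> op_comp X a (op_adj b) = 0"
      by (simp flip: op_comp_assoc)
  qed
  then show "op_comp X a b = 0" "op_comp X a (op_adj b) = 0" by blast+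
qed

text \<open>The component of the identity in the span of \<open>F\<^sub>g\<^sub>t\<^sup>\<dagger> F\<^sub>g\<^sub>t\<close> is automatically a projection:
  \<open>P\<^sub>t P\<^sub>u\<^sup>\<dagger> = 0\<close> for \<open>u \<noteq> t\<close> gives \<open>P\<^sub>t = P\<^sub>t (\<Sum>u. P\<^sub>u)\<^sup>\<dagger> = P\<^sub>t P\<^sub>t\<^sup>\<dagger>\<close>.\<close>

lemma projective_coloring_of_family:
  fixes F :: "('g \<times> 'x, 't) qrelation"
  assumes G: "pair_graph G" and T: "finite T" and \<X>: "quantum_set \<X>" and X: "X \<in> \<X>"
    and F: "quantum_coloring_family G T \<X> F"
  shows "\<exists>P. projective_coloring G T X P"
proof -
  have fin: "finite X" using \<X> X by (auto simp: quantum_set_def)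
  have func: "qfunction (qset_prod (classical_qset (pverts G)) \<X>) (classical_qset T) F"
    using F by (simp add: quantum_coloring_family_def)
  have atoms: "{g} \<times> Y \<in> qset_prod (classical_qset (pverts G)) \<X>" if "g \<in> pverts G" "Y \<in> \<X>" for g Y
    using that by (auto simp: qset_prod_classical_iff)
  have points: "{t} \<in> classical_qset T" if "t \<in> T" for t
    using that by (auto simp: classical_qset_def)
  have rel: "F ({g} \<times> Y) {t} \<subseteq> lin_ops ({g} \<times> Y) {t}" "csubspace (F ({g} \<times> Y) {t})"
    if "g \<in> pverts G" "Y \<in> \<X>" "t \<in> T" for g Y t
    using func atoms[OF that(1,2)] points[OF that(3)] by (auto simp: qfunction_def qrel_def)
  define M where "M = (\<lambda>g t. op_slice g ` F ({g} \<times> X) {t})"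
  define S where "S = (\<lambda>g t. {op_comp {t} (op_adj s) r | s r. s \<in> M g t \<and> r \<in> M g t})"
  have member: "qfamily_member (pverts G) \<X> F g Y {t} = op_slice g ` F ({g} \<times> Y) {t}"
    if "g \<in> pverts G" "Y \<in> \<X>" "t \<in> T" for g Y t
    using rel[OF that] by (intro qfamily_member_eq[OF \<X> that(1,2)])
  have M_lin: "r \<in> lin_ops X {t}" if "g \<in> pverts G" "t \<in> T" "r \<in> M g t" for g t r
    using rel[OF that(1) X that(2)] that(3) by (auto simp: M_def intro: op_slice_lin_ops)
  \<comment> \<open>The bound on \<open>F\<close> after its adjoint by the identity relation:
    distinct points of \<open>T\<close> are related only by zero.\<close>
  have orth: "op_comp X r (op_adj s) = 0"
    if g: "g \<in> pverts G" and t: "t \<in> T" "t' \<in> T" "t \<noteq> t'" and rs: "r \<in> M g t" "s \<in> M g t'" for g t t' r s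
  proof -
    obtain r0 s0 where r0: "r0 \<in> F ({g} \<times> X) {t}" "r = op_slice g r0"
      and s0: "s0 \<in> F ({g} \<times> X) {t'}" "s = op_slice g s0"
      using rs by (auto simp: M_def)
    have "op_comp ({g} \<times> X) r0 (op_adj s0)
        \<in> qrel_comp (qset_prod (classical_qset (pverts G)) \<X>) F (qrel_adj F) {t'} {t}"
      using r0 s0 by (intro qrel_compI atoms[OF g X]) (auto simp: qrel_adj_def)
    also have "\<dots> \<subseteq> qrel_id {t'} {t}"
      using func points t unfolding qfunction_def qrel_le_def by blast
    finally show ?thesis using t r0 s0 by (simp add: qrel_id_def op_comp_slice)
  qed
  have arc: "op_comp X r (op_adj s) = 0"
    if e: "(g, g') \<in> parcs G" and t: "t \<in> T" and rs: "r \<in> M g t" "s \<in> M g' t" for g g' t r s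
  proof -
    have g: "g \<in> pverts G" "g' \<in> pverts G" using pair_graph_arc_verts[OF G e] by auto
    have mem: "r \<in> qfamily_member (pverts G) \<X> F g X {t}" "s \<in> qfamily_member (pverts G) \<X> F g' X {t}"
      using rs member[OF _ X t] g by (simp_all add: M_def)
    have "qpred_disjoint \<X>
        (qpred_inv_image (classical_qset T) (qfamily_member (pverts G) \<X> F g) (qpred_point t))
        (qpred_inv_image (classical_qset T) (qfamily_member (pverts G) \<X> F g') (qpred_point t))"
      using F e t by (auto simp: quantum_coloring_family_def)
    then show ?thesis
      using t mem X rel g
      by (subst (asm) qpred_disjoint_point_iff[OF t]) (auto simp: member dest!: subsetD intro!: op_slice_lin_ops)
  qed
  have "\<exists>P. (\<forall>t\<in>T. P t \<in> cspan (S g t)) \<and> (\<Sum>t\<in>T. P t) = op_id X" if g: "g \<in> pverts G" for g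
  proof -
    \<comment> \<open>The sum of the spans over all colors. The other half of being a function puts
      the identity into it; \<open>L\<close> is the slice at \<open>g\<close> on both sides.\<close>
    define D where "D = {\<Sum>t\<in>T. P t | P. \<forall>t\<in>T. P t \<in> cspan (S g t)}"
    have D: "csubspace D"
      unfolding cfun.subspace_def
    proof (intro conjI ballI allI)
      show "0 \<in> D" unfolding D_def by (auto intro!: exI[of _ "\<lambda>_. 0"] cfun.span_zero)
      show "x + y \<in> D" if xy: "x \<in> D" "y \<in> D" for x y
      proof -
        obtain P Q where "x = (\<Sum>t\<in>T. P t)" "y = (\<Sum>t\<in>T. Q t)"
          "\<forall>t\<in>T. P t \<in> cspan (S g t)" "\<forall>t\<in>T. Q t \<in> cspan (S g t)"
          using xy unfolding D_def by blast
        then show ?thesis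
          unfolding D_def
          by (auto intro!: exI[of _ "\<lambda>t. P t + Q t"] cfun.span_add simp: sum.distrib)
      qed
      show "cscale c x \<in> D" if xy: "x \<in> D" for c x
      proof -
        obtain P where "x = (\<Sum>t\<in>T. P t)" "\<forall>t\<in>T. P t \<in> cspan (S g t)"
          using xy unfolding D_def by blast
        then show ?thesis
          unfolding D_def
          by (auto intro!: exI[of _ "\<lambda>t. cscale c (P t)"] cfun.span_scale simp: cfun.scale_sum_right)
      qed
    qed
    define L where "L = (\<lambda>a :: ('g \<times> 'x) \<times> ('g \<times> 'x) \<Rightarrow> complex. \<lambda>(j, i). a ((g, j), (g, i)))"
    have "op_id ({g} \<times> X) \<in> qrel_id ({g} \<times> X) ({g} \<times> X)"
      by (auto simp: qrel_id_def intro!: exI[of _ 1])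
    then have "op_id ({g} \<times> X) \<in> qrel_comp (classical_qset T) (qrel_adj F) F ({g} \<times> X) ({g} \<times> X)"
      using func atoms[OF g X] unfolding qfunction_def qrel_le_def by blast
    then have "L (op_id ({g} \<times> X)) \<in> D"
      unfolding qrel_comp_def
    proof (rule cspan_linear[OF _ D])
      fix a assume "a \<in> {op_comp Y s r | Y s r. Y \<in> classical_qset T \<and>
        s \<in> qrel_adj F Y ({g} \<times> X) \<and> r \<in> F ({g} \<times> X) Y}"
      then obtain t s r where t: "t \<in> T" and a: "a = op_comp {t} (op_adj s) r"
        and sr: "s \<in> F ({g} \<times> X) {t}" "r \<in> F ({g} \<times> X) {t}"
        by (auto simp: classical_qset_def qrel_adj_def)
      have "L a = op_comp {t} (op_adj (op_slice g s)) (op_slice g r)"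
        by (auto simp: L_def a fun_eq_iff)
      then have "L a \<in> cspan (S g t)"
        using sr unfolding S_def M_def by (intro cfun.span_base) blast
      then show "L a \<in> D"
        unfolding D_def using t T
        by (auto intro!: exI[of _ "\<lambda>t'. if t' = t then L a else 0"] cfun.span_zero)
    qed (auto simp: L_def fun_eq_iff cscale_def)
    also have "L (op_id ({g} \<times> X)) = op_id X"
      by (auto simp: L_def fun_eq_iff)
    finally show ?thesis unfolding D_def by force
  qed
  then obtain P where P: "\<And>g t. g \<in> pverts G \<Longrightarrow> t \<in> T \<Longrightarrow> P g t \<in> cspan (S g t)"
    and sum: "\<And>g. g \<in> pverts G \<Longrightarrow> (\<Sum>t\<in>T. P g t) = op_id X"
    by metis
  have lin: "P g t \<in> lin_ops X X" if "g \<in> pverts G" "t \<in> T" for g t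
  proof -
    have "S g t \<subseteq> lin_ops X X"
      using M_lin[OF that] by (auto simp: S_def intro!: op_comp_lin_ops[where Y = "{t}"] op_adj_lin_ops)
    then show ?thesis
      using P[OF that] cfun.span_minimal[OF _ csubspace_lin_ops] by blast
  qed
  have orth': "op_comp X (P g t) (P g t') = 0" "op_comp X (P g t) (op_adj (P g t')) = 0"
    if "g \<in> pverts G" "t \<in> T" "t' \<in> T" "t \<noteq> t'" for g t t'
    using op_comp_span_zero[OF orth[OF that] P[OF that(1,2), unfolded S_def] P[OF that(1,3), unfolded S_def]]
    by simp_all
  have arc': "op_comp X (P g t) (P g' t) = 0" if "(g, g') \<in> parcs G" "t \<in> T" for g g' t
  proof -
    have g: "g \<in> pverts G" "g' \<in> pverts G" using pair_graph_arc_verts[OF G that(1)] by auto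
    show ?thesis
      using op_comp_span_zero[OF arc[OF that] P[OF g(1) that(2), unfolded S_def] P[OF g(2) that(2), unfolded S_def]]
      by simp
  qed
  have herm: "op_adj (P g t) = P g t" if "g \<in> pverts G" "t \<in> T" for g t
  proof -
    have "P g t = op_comp X (P g t) (op_adj (\<Sum>t'\<in>T. P g t'))"
      using fin that by (simp add: sum lin op_comp_id_right[where Y = X])
    also have "\<dots> = (\<Sum>t'\<in>T. if t' = t then op_comp X (P g t) (op_adj (P g t)) else 0)"
      unfolding op_adj_sum op_comp_sum_right using orth' that by (intro sum.cong) auto
    finally have "P g t = op_comp X (P g t) (op_adj (P g t))" using T that by simp
    then show ?thesis by (metis op_adj_adj op_adj_comp)
  qed
  have "projective_coloring G T X P"
    using lin herm sum orth' arc' by (auto simp: projective_coloring_def)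
  then show ?thesis by blast
qed


text \<open>The family is \<open>F({g} \<times> H, {t}) = {r. r P\<^sub>g\<^sub>t = r}\<close>, the functionals on the range of \<open>P\<^sub>g\<^sub>t\<close>.\<close>

lemma family_of_projective_coloring:
  fixes P :: "'g \<Rightarrow> 't \<Rightarrow> ('x \<times> 'x \<Rightarrow> complex)"
  assumes G: "pair_graph G" and T: "finite T" and H: "finite H" "H \<noteq> {}"
    and P: "projective_coloring G T H P"
  shows "\<exists>F. quantum_coloring_family G T {H} F"
proof -
  note D = projective_coloringD[OF P]
  have H_set: "quantum_set {H}" using H by (simp add: quantum_set_def)
  \<comment> \<open>As \<open>H\<close> is nonempty, the atoms \<open>{g} \<times> H\<close> and
    \<open>{t}\<close> determine \<open>g\<close> and \<open>t\<close>, so the quantifier imposes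
    one condition there.\<close>
  define F :: "('g \<times> 'x, 't) qrelation" where "F = (\<lambda>Q Y. {r \<in> lin_ops Q Y. \<forall>g t. Q = {g} \<times> H \<and> Y = {t} \<longrightarrow>
    op_comp H (op_slice g r) (P g t) = op_slice g r})"
  have F_iff: "r \<in> F ({g} \<times> H) {t} \<longleftrightarrow>
      r \<in> lin_ops ({g} \<times> H) {t} \<and> op_comp H (op_slice g r) (P g t) = op_slice g r" for g t r
    using H by (auto simp: F_def times_eq_iff)
  have F_lin: "F Q Y \<subseteq> lin_ops Q Y" for Q Y by (auto simp: F_def)
  have F_sub: "csubspace (F Q Y)" for Q Y
    using csubspace_lin_ops[of Q Y] op_slice_linear(2)[of _ 0]
    by (auto simp: F_def cfun.subspace_def op_slice_linear op_comp_add op_comp_scale)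
  \<comment> \<open>Inserting \<open>P g t\<close> next to \<open>r\<close> and
    \<open>P g' t'\<close> next to \<open>s\<close> creates the product assumed to vanish.\<close>
  have orth: "op_comp H (op_slice g r) (op_adj (op_slice g' s)) = 0"
    if zero: "op_comp H (P g t) (P g' t') = 0" and g: "g' \<in> pverts G" "t' \<in> T"
      and r: "r \<in> F ({g} \<times> H) {t}" and s: "s \<in> F ({g'} \<times> H) {t'}" for g g' t t' r s
  proof -
    define R S where "R = op_slice g r" and "S = op_slice g' s"
    have RS: "op_comp H R (P g t) = R" "op_comp H S (P g' t') = S"
      using r s by (auto simp: F_iff R_def S_def)
    have "op_comp H R (op_adj S) = op_comp H (op_comp H R (P g t)) (op_adj (op_comp H S (P g' t')))"
      by (simp add: RS)
    also have "\<dots> = op_comp H (op_comp H R (op_comp H (P g t) (P g' t'))) (op_adj S)"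
      using D(2)[OF g] by (simp add: op_adj_comp op_comp_assoc)
    finally show ?thesis by (simp add: zero R_def S_def)
  qed
  have "qrel_le (qset_prod (classical_qset (pverts G)) {H}) (qset_prod (classical_qset (pverts G)) {H})
      qrel_id (qrel_comp (classical_qset T) (qrel_adj F) F)"
    unfolding qrel_le_def qset_prod_classical_iff Ball_def
  proof (intro allI impI, clarsimp)
    fix g g' k assume g: "g \<in> pverts G" and k: "k \<in> qrel_id ({g} \<times> H) ({g'} \<times> H)"
    show "k \<in> qrel_comp (classical_qset T) (qrel_adj F) F ({g} \<times> H) ({g'} \<times> H)"
    proof (cases "{g} \<times> H = {g'} \<times> H")
      case False
      then show ?thesis using k by (auto simp: qrel_id_def qrel_comp_def cfun.span_zero)
    next
      case True
      then have [simp]: "g' = g" using H by auto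
      let ?C = "qrel_comp (classical_qset T) (qrel_adj F) F ({g} \<times> H) ({g} \<times> H)"
      \<comment> \<open>Row \<open>h\<close> of \<open>P g t\<close> as a functional at color
        \<open>t\<close>. Summed over \<open>h\<close>, the adjoint squares of the rows give the
        adjoint square of \<open>P g t\<close>, which is \<open>P g t\<close>; summed over
        \<open>t\<close>, they give the identity.\<close>
      define row where "row = (\<lambda>t h. \<lambda>(k, (h', i)). if k = t \<and> h' = g \<and> i \<in> H then P g t (h, i) else 0)"
      have row: "row t h \<in> F ({g} \<times> H) {t}" if "t \<in> T" "h \<in> H" for t h
      proof -
        have "op_comp H (op_slice g (row t h)) (P g t) (k, i) = op_slice g (row t h) (k, i)" for k i
          using fun_cong[OF projective_coloring_idem[OF P T H(1) g that(1)], of "(h, i)"]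
            lin_ops_outside[OF D(1)[OF g that(1)], of _ i]
          by (auto simp: row_def cong: sum.cong)
        then have "op_comp H (op_slice g (row t h)) (P g t) = op_slice g (row t h)"
          by (auto simp: fun_eq_iff)
        then show ?thesis by (auto simp: F_iff row_def lin_ops_iff)
      qed
      have "op_comp {t} (op_adj (row t h)) (row t h) \<in> ?C" if "t \<in> T" "h \<in> H" for t h
        using row[OF that] that(1) by (intro qrel_compI) (auto simp: classical_qset_def qrel_adj_def)
      then have "(\<Sum>t\<in>T. \<Sum>h\<in>H. op_comp {t} (op_adj (row t h)) (row t h)) \<in> ?C"
        unfolding qrel_comp_def by (intro cfun.span_sum) auto
      moreover have "(\<Sum>t\<in>T. \<Sum>h\<in>H. op_comp {t} (op_adj (row t h)) (row t h)) = op_id ({g} \<times> H)"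
      proof -
        have "(\<Sum>t\<in>T. \<Sum>h\<in>H. op_comp {t} (op_adj (row t h)) (row t h)) ((a, j), (b, i)) =
            op_id ({g} \<times> H) ((a, j), (b, i))" for a b i j
        proof (cases "a = g \<and> b = g \<and> i \<in> H \<and> j \<in> H")
          case True
          have "(\<Sum>t\<in>T. \<Sum>h\<in>H. op_comp {t} (op_adj (row t h)) (row t h)) ((a, j), (b, i)) =
              (\<Sum>t\<in>T. op_comp H (op_adj (P g t)) (P g t) (j, i))"
            using True by (simp add: sum_fun_apply row_def)
          also have "\<dots> = (\<Sum>t\<in>T. P g t (j, i))"
            using D(2)[OF g] projective_coloring_idem[OF P T H(1) g] by (intro sum.cong) auto
          also have "\<dots> = op_id H (j, i)"
            using fun_cong[OF D(3)[OF g], of "(j, i)"] by (simp add: sum_fun_apply)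
          finally show ?thesis using True by simp
        next
          case False
          then have "(\<Sum>t\<in>T. \<Sum>h\<in>H. op_comp {t} (op_adj (row t h)) (row t h)) ((a, j), (b, i)) = 0"
            unfolding sum_fun_apply by (intro sum.neutral ballI) (auto simp: row_def)
          with False show ?thesis by auto
        qed
        then show ?thesis by (auto simp: fun_eq_iff)
      qed
      ultimately have "op_id ({g} \<times> H) \<in> ?C" by simp
      then show ?thesis
        using k by (auto simp: qrel_id_def qrel_comp_def intro: cfun.span_scale)
    qed
  qed
  moreover have "qrel_le (classical_qset T) (classical_qset T)
      (qrel_comp (qset_prod (classical_qset (pverts G)) {H}) F (qrel_adj F)) qrel_id"
    unfolding qrel_le_def
  proof (intro ballI)
    fix Y Y' assume "Y \<in> classical_qset T" "Y' \<in> classical_qset T"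
    then obtain t t' where t: "t \<in> T" "t' \<in> T" and [simp]: "Y = {t}" "Y' = {t'}"
      by (auto simp: classical_qset_def)
    show "qrel_comp (qset_prod (classical_qset (pverts G)) {H}) F (qrel_adj F) Y Y' \<subseteq> qrel_id Y Y'"
      unfolding qrel_comp_def
    proof (rule cfun.span_minimal[OF _ csubspace_qrel_id], clarify)
      fix Q r s assume "Q \<in> qset_prod (classical_qset (pverts G)) {H}" and r: "r \<in> F Q Y'"
        and s: "s \<in> qrel_adj F Y Q"
      then obtain g where g: "g \<in> pverts G" and [simp]: "Q = {g} \<times> H"
        by (auto simp: qset_prod_classical_iff)
      obtain s' where s': "s' \<in> F ({g} \<times> H) {t}" "s = op_adj s'"
        using s by (auto simp: qrel_adj_def)
      show "op_comp Q r s \<in> qrel_id Y Y'"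
      proof (cases "t = t'")
        case True
        have "op_comp Q r s \<in> lin_ops {t} {t}"
          using r s' F_lin True by (auto intro!: op_comp_lin_ops[where Y = "{g} \<times> H"] op_adj_lin_ops)
        then have "op_comp Q r s = cscale (op_comp Q r s (t, t)) (op_id {t})"
          by (intro lin_ops_eqI[of _ "{t}" "{t}"]) (auto simp: lin_ops_iff cscale_def simp del: op_comp_apply)
        then show ?thesis using True by (auto simp: qrel_id_def)
      next
        case False
        then have "op_comp Q r s = 0"
          using orth[OF D(4)[OF g t(2,1)] g t(1)] r s' by (simp add: op_comp_slice)
        with False show ?thesis by (simp add: qrel_id_def)
      qed
    qed
  qed
  ultimately have "qfunction (qset_prod (classical_qset (pverts G)) {H}) (classical_qset T) F"
    using F_lin F_sub by (simp add: qfunction_def qrel_def)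
  moreover have "qpred_disjoint {H}
      (qpred_inv_image (classical_qset T) (qfamily_member (pverts G) {H} F g) (qpred_point t))
      (qpred_inv_image (classical_qset T) (qfamily_member (pverts G) {H} F g') (qpred_point t))"
    if e: "(g, g') \<in> parcs G" and t: "t \<in> T" for g g' t
  proof -
    have g: "g \<in> pverts G" "g' \<in> pverts G" using pair_graph_arc_verts[OF G e] by auto
    have member: "qfamily_member (pverts G) {H} F h H {t} = op_slice h ` F ({h} \<times> H) {t}" if "h \<in> pverts G" for h
      using that F_lin F_sub by (intro qfamily_member_eq[OF H_set]) auto
    have lin: "op_slice h ` F ({h} \<times> H) {t} \<subseteq> lin_ops H {t}" for h
      using F_lin[of "{h} \<times> H" "{t}"] op_slice_lin_ops[of _ h H "{t}"] by blast
    show ?thesis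
      using orth[OF D(5)[OF e t] g(2) t] lin by (subst qpred_disjoint_point_iff[OF t]) (auto simp: member g)
  qed
  ultimately have "quantum_coloring_family G T {H} F"
    by (auto simp: quantum_coloring_family_def)
  then show ?thesis by blast
qed

section \<open>The equivalence\<close>

theorem proposition1p2:
  fixes G :: "'g pair_pre_digraph" and T :: "'t set"
  assumes "pair_graph G" and "finite T"
  shows
    "((\<exists>(A :: 'a::infinite set) (B :: 'b::infinite set) \<psi> E E'.
         winning_strategy G T A B \<psi> E E')
      \<longleftrightarrow>
      (\<exists>(\<X> :: 'x::infinite set set) F.
         quantum_set \<X> \<and> \<X> \<noteq> classical_qset {} \<and> quantum_coloring_family G T \<X> F))
     \<and>
     ((\<exists>(\<X> :: 'x set set) F.
         quantum_set \<X> \<and> \<X> \<noteq> classical_qset {} \<and> quantum_coloring_family G T \<X> F)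
      \<longleftrightarrow>
      (\<exists>(H :: 'h::infinite set) F.
         finite H \<and> H \<noteq> {} \<and> quantum_coloring_family G T {H} F))"
    (is "(?game \<longleftrightarrow> ?family) \<and> (_ \<longleftrightarrow> ?single)")
proof -
  have single_family: "quantum_set {H}" "{H} \<noteq> classical_qset {}" if "finite H" "H \<noteq> {}" for H :: "'y set"
    using that by (auto simp: quantum_set_def classical_qset_def)
  have family: ?family if ?game
  proof -
    \<comment> \<open>Gram-Schmidt can choose its index set in any infinite type, here directly in
      that of the quantum set.\<close>
    obtain H :: "'x set" and P where H: "finite H" "H \<noteq> {}" "projective_coloring G T H P"
      using projective_coloring_of_winning_strategy[OF assms] \<open>?game\<close> by metis
    then show ?family
      using family_of_projective_coloring[OF assms H] single_family[OF H(1,2)] by blast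
  qed
  \<comment> \<open>A nonempty quantum set has an atom, and the projective coloring found on this
    atom gives both other conditions.\<close>
  have both: "?game \<and> ?single" if ?family
  proof -
    obtain \<X> :: "'x set set" and F where "quantum_set \<X>" "\<X> \<noteq> classical_qset {}"
      and F: "quantum_coloring_family G T \<X> F"
      using \<open>?family\<close> by blast
    then obtain X where X: "X \<in> \<X>" "finite X" "X \<noteq> {}"
      by (auto simp: quantum_set_def classical_qset_def)
    obtain P where P: "projective_coloring G T X P"
      using projective_coloring_of_family[OF assms \<open>quantum_set \<X>\<close> X(1) F] by blast
    obtain H :: "'h set" and Q where H: "finite H" "H \<noteq> {}" "projective_coloring G T H Q"
      using projective_coloring_transport[OF assms X(2,3) P] by blast
    have ?single using family_of_projective_coloring[OF assms H] H(1,2) by blast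
    with winning_strategy_of_projective_coloring[OF assms X(2,3) P] show ?thesis by (rule conjI)
  qed
  have family': ?family if ?single
  proof -
    obtain H :: "'h set" and F where H: "finite H" "H \<noteq> {}" and F: "quantum_coloring_family G T {H} F"
      using \<open>?single\<close> by blast
    obtain P where P: "projective_coloring G T H P"
      using projective_coloring_of_family[OF assms single_family(1)[OF H] _ F] by blast
    obtain X :: "'x set" and Q where X: "finite X" "X \<noteq> {}" "projective_coloring G T X Q"
      using projective_coloring_transport[OF assms H P] by blast
    then show ?family
      using family_of_projective_coloring[OF assms X] single_family[OF X(1,2)] by blast
  qed
  show ?thesis
    by (rule conjI[OF iffI[OF family conjunct1[OF both]] iffI[OF conjunct2[OF both] family']])
qed

end
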